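(* Let $q$ be a prime power, let $n\ge 1$ with $\gcd(n,q)=1$, and let $C_1$ and $C_2$ be cyclic codes of length $n$ over $\mathbb{F}_q$ with parameters $[n,k_1,d_1]_q$ and $[n,k_2,d_2]_q$, respectively, whose defining sets are taken with respect to the same primitive $n$-th root of unity. Then there exists a QUENTA code with parameters $$[[\,n,\; k_1-|Z(C_1^\perp)\cap Z(C_2)|,\; \min\{d_1,d_2\};\; n-k_2-|Z(C_1^\perp)\cap Z(C_2)|\,]]_q .$$
   Context: A linear $[n,k,d]_q$ code is a $k$-dimensional subspace of $\mathbb{F}_q^n$ with minimum Hamming distance $d$; $C^\perp$ denotes its Euclidean dual. For $\gcd(n,q)=1$, a cyclic code $C$ of length $n$ over $\mathbb{F}_q$ is identified with an ideal of $\mathbb{F}_q[x]/(x^n-1)$; fixing a primitive $n$-th root of unity $\alpha$ in an extension field of $\mathbb{F}_q$, the defining set of $C$ is $Z(C)=\{i\in\mathbb{Z}_n : c(\alpha^i)=0 \text{ for all } c(x)\in C\}$, and $\dim C=n-|Z(C)|$. A QUENTA code (entanglement-assisted quantum error-correcting code) with parameters $[[n,k,d;c]]_q$ is a $q$-ary entanglement-assisted quantum stabilizer code that encodes $k$ logical qudits into $n$ physical qudits using $c$ pairs of maximally entangled qudits pre-shared between sender and receiver, and has minimum distance $d$ (every error acting nontrivially on fewer than $d$ of the $n$ sender's qudits is detectable). *)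

theory Defs
  imports Complex_Main "HOL-Library.Function_Algebras" "HOL-Library.Cardinality"
begin

text \<open>Vectors of length n over a field are modelled as functions nat => 'a vanishing
  from index n on; coordinates are indexed 0..n-1.\<close>

type_synonym 'a word = "nat \<Rightarrow> 'a"

definition Fn :: "nat \<Rightarrow> ('a::zero) word set" where
  "Fn n = {v. \<forall>i\<ge>n. v i = 0}"

definition cscale :: "'a::field \<Rightarrow> 'a word \<Rightarrow> 'a word" where
  "cscale c v = (\<lambda>i. c * v i)"

definition linear_code :: "nat \<Rightarrow> ('a::field) word set \<Rightarrow> bool" where
  "linear_code n C \<longleftrightarrow> C \<subseteq> Fn n \<and> 0 \<in> C \<and> (\<forall>u\<in>C. \<forall>v\<in>C. u + v \<in> C)
     \<and> (\<forall>c. \<forall>v\<in>C. cscale c v \<in> C)"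

definition code_dim :: "('a::field) word set \<Rightarrow> nat" where
  "code_dim C = vector_space.dim cscale C"

definition hdist :: "nat \<Rightarrow> ('a::zero) word \<Rightarrow> 'a word \<Rightarrow> nat" where
  "hdist n u v = card {i. i < n \<and> u i \<noteq> v i}"

text \<open>C is an [n,k,d]_q code. For the zero code the minimum distance is unconstrained.\<close>
definition has_params :: "nat \<Rightarrow> nat \<Rightarrow> nat \<Rightarrow> ('a::field) word set \<Rightarrow> bool" where
  "has_params n k d C \<longleftrightarrow> linear_code n C \<and> code_dim C = k
     \<and> (\<forall>u\<in>C. \<forall>v\<in>C. u \<noteq> v \<longrightarrow> d \<le> hdist n u v)
     \<and> (C \<noteq> {0} \<longrightarrow> (\<exists>u\<in>C. \<exists>v\<in>C. u \<noteq> v \<and> hdist n u v = d))"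

definition cshift :: "nat \<Rightarrow> ('a::zero) word \<Rightarrow> 'a word" where
  "cshift n v = (\<lambda>i. if i < n then v ((i + n - 1) mod n) else 0)"

definition cyclic_code :: "nat \<Rightarrow> ('a::field) word set \<Rightarrow> bool" where
  "cyclic_code n C \<longleftrightarrow> linear_code n C \<and> (\<forall>v\<in>C. cshift n v \<in> C)"

definition dual_code :: "nat \<Rightarrow> ('a::field) word set \<Rightarrow> 'a word set" where
  "dual_code n C = {v \<in> Fn n. \<forall>c\<in>C. (\<Sum>i<n. v i * c i) = 0}"

definition field_hom :: "('a::field \<Rightarrow> 'b::field) \<Rightarrow> bool" where
  "field_hom emb \<longleftrightarrow> (\<forall>x y. emb (x + y) = emb x + emb y) \<and> (\<forall>x y. emb (x * y) = emb x * emb y)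
     \<and> emb 1 = 1"

definition primitive_root_of_unity :: "nat \<Rightarrow> 'b::field \<Rightarrow> bool" where
  "primitive_root_of_unity n \<alpha> \<longleftrightarrow> \<alpha> ^ n = 1 \<and> (\<forall>i. 0 < i \<and> i < n \<longrightarrow> \<alpha> ^ i \<noteq> 1)"

definition cw_eval :: "('a::field \<Rightarrow> 'b::field) \<Rightarrow> nat \<Rightarrow> 'a word \<Rightarrow> 'b \<Rightarrow> 'b" where
  "cw_eval emb n c \<beta> = (\<Sum>j<n. emb (c j) * \<beta> ^ j)"

definition defining_set :: "('a::field \<Rightarrow> 'b::field) \<Rightarrow> 'b \<Rightarrow> nat \<Rightarrow> 'a word set \<Rightarrow> nat set" where
  "defining_set emb \<alpha> n C = {i. i < n \<and> (\<forall>c\<in>C. cw_eval emb n c (\<alpha> ^ i) = 0)}"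

text \<open>A state of N qudits: a complex function on the computational basis Fn N.\<close>
type_synonym 'a state = "'a word \<Rightarrow> complex"

definition Hspace :: "nat \<Rightarrow> ('a::zero) state set" where
  "Hspace N = {\<psi>. \<forall>x. x \<notin> Fn N \<longrightarrow> \<psi> x = 0}"

definition inner_st :: "nat \<Rightarrow> ('a::zero) state \<Rightarrow> 'a state \<Rightarrow> complex" where
  "inner_st N u w = (\<Sum>x\<in>Fn N. cnj (u x) * w x)"

text \<open>Absolute trace F_q -> F_p (q = p^m) and additive character omega^(tr x), omega = e^(2 pi i/p).\<close>
definition abs_trace :: "'a::{finite,field} \<Rightarrow> 'a" where
  "abs_trace x = sum (\<lambda>i. x ^ (CHAR('a) ^ i)) {..<(THE m. CHAR('a) ^ m = CARD('a))}"

definition addchar :: "'a::{finite,field} \<Rightarrow> complex" where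
  "addchar x = cis (2 * pi * real (LEAST j. (of_nat j :: 'a) = abs_trace x) / real CHAR('a))"

text \<open>The generalized Pauli operator X(a)Z(b) on N qudits:
  Z(b)|x> = omega^(tr(b.x))|x>,  X(a)|x> = |x+a>.\<close>
definition pauli :: "nat \<Rightarrow> ('a::{finite,field}) word \<Rightarrow> 'a word \<Rightarrow> 'a state \<Rightarrow> 'a state" where
  "pauli N a b \<psi> = (\<lambda>y. if y \<in> Fn N then addchar (\<Sum>i<N. b i * (y i - a i)) * \<psi> (y - a) else 0)"

definition sweight :: "nat \<Rightarrow> ('a::zero) word \<Rightarrow> 'a word \<Rightarrow> nat" where
  "sweight n a b = card {i. i < n \<and> (a i \<noteq> 0 \<or> b i \<noteq> 0)}"

text \<open>Error E is detectable by the code Q (Knill--Laflamme): P E P is a multiple of P.\<close>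
definition detectable :: "nat \<Rightarrow> ('a::zero) state set \<Rightarrow> ('a state \<Rightarrow> 'a state) \<Rightarrow> bool" where
  "detectable N Q E \<longleftrightarrow> (\<exists>\<mu>. \<forall>u\<in>Q. \<forall>v\<in>Q. inner_st N u (E v) = \<mu> * inner_st N u v)"

definition restr :: "nat \<Rightarrow> ('a::zero) word \<Rightarrow> 'a word" where
  "restr n x = (\<lambda>i. if i < n then x i else 0)"

definition glue :: "nat \<Rightarrow> 'a word \<Rightarrow> 'a word \<Rightarrow> 'a word" where
  "glue n x y = (\<lambda>i. if i < n then x i else y i)"

text \<open>A unitary on the sender's n qudits, given by its matrix U y x = <y|U|x>.\<close>
definition unitary_on :: "nat \<Rightarrow> (('a::zero) word \<Rightarrow> 'a word \<Rightarrow> complex) \<Rightarrow> bool" where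
  "unitary_on n U \<longleftrightarrow> (\<forall>x\<in>Fn n. \<forall>x'\<in>Fn n.
      (\<Sum>y\<in>Fn n. cnj (U y x) * U y x') = (if x = x' then 1 else 0))"

text \<open>U tensor identity: U acts on qudits 0..n-1 (sender), identity on qudits n.. (receiver).\<close>
definition apply_sender :: "nat \<Rightarrow> (('a::zero) word \<Rightarrow> 'a word \<Rightarrow> complex) \<Rightarrow> 'a state \<Rightarrow> 'a state" where
  "apply_sender n U \<Psi> = (\<lambda>y. \<Sum>x\<in>Fn n. U (restr n y) x * \<Psi> (glue n x y))"

text \<open>Unencoded input on n+c qudits: |phi> (k information qudits 0..k-1) tensor |0> on qudits
  k..n-c-1 tensor c maximally entangled pairs q^(-1/2) sum_x |x>|x>, the j-th pair being
  sender qudit n-c+j and receiver qudit n+j.\<close>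
definition ea_input :: "nat \<Rightarrow> nat \<Rightarrow> nat \<Rightarrow> ('a::{finite,field}) state \<Rightarrow> 'a state" where
  "ea_input n k c \<phi> = (\<lambda>x. if x \<in> Fn (n + c) \<and> (\<forall>i. k \<le> i \<and> i < n - c \<longrightarrow> x i = 0)
        \<and> (\<forall>j<c. x (n - c + j) = x (n + j))
     then \<phi> (restr k x) / complex_of_real (sqrt (real CARD('a)) ^ c) else 0)"

text \<open>Q is a QUENTA code [[n,k,d;c]]_q: it is obtained by applying a unitary on the sender's
  n qudits to k information qudits, ancillas and c ebits; it is a stabilizer code
  (common eigenspace of a set of Pauli operators on the n+c qudits); and every error
  acting on fewer than d of the sender's qudits is detectable.\<close>
definition quenta_code :: "nat \<Rightarrow> nat \<Rightarrow> nat \<Rightarrow> nat \<Rightarrow> ('a::{finite,field}) state set \<Rightarrow> bool" where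
  "quenta_code n k d c Q \<longleftrightarrow> k + c \<le> n
     \<and> (\<exists>U. unitary_on n U \<and> Q = {apply_sender n U (ea_input n k c \<phi>) | \<phi>. \<phi> \<in> Hspace k})
     \<and> (\<exists>S. (\<forall>(ph, a, b)\<in>S. a \<in> Fn (n + c) \<and> b \<in> Fn (n + c))
          \<and> Q = {\<psi> \<in> Hspace (n + c). \<forall>(ph, a, b)\<in>S. (\<lambda>y. ph * pauli (n + c) a b \<psi> y) = \<psi>})
     \<and> (\<forall>a\<in>Fn n. \<forall>b\<in>Fn n. sweight n a b < d \<longrightarrow> detectable (n + c) Q (pauli (n + c) a b))"

end

theory Submission
  imports Defs "HOL-Computational_Algebra.Polynomial" "HOL-Number_Theory.Cong" "HOL-Library.FuncSet"
begin

text \<open>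
  Put \<open>V = C1\<^sup>\<bottom>\<close>. Choose a basis of the ambient space that contains bases of \<open>V \<inter> C2\<close>, \<open>V\<close> and
  \<open>C2\<close>. In these coordinates \<open>C2\<close> is spanned by the first \<open>k + s\<close> unit vectors, where
  \<open>s = dim (V \<inter> C2)\<close>, and \<open>V\<close> by the \<open>s\<close> unit vectors from \<open>k\<close> on and the last \<open>c\<close> ones. The encoder
  is this change of coordinates preceded by a Fourier transform on the \<open>s\<close> ancillas that belong to
  \<open>V \<inter> C2\<close>. The code space consists of the states that are supported on a subspace of \<open>F\<^sup>n\<^sup>+\<^sup>c\<close> whose
  part with zero receiver coordinates is \<open>C2\<close>, and that are invariant under translation
  by a subspace projecting onto \<open>V\<close>. An error \<open>X(a) Z(b)\<close> of the sender is therefore detected with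
  scalar zero unless \<open>a \<in> C2\<close> and \<open>b \<in> V\<^sup>\<bottom> = C1\<close>; below weight \<open>min d1 d2\<close> only the identity remains.

  For the parameters, \<open>Z(V) \<inter> Z(C2) = Z(V + C2)\<close> and \<open>V + C2\<close> is cyclic, so by counting roots of
  its generator polynomial the intersection has \<open>n - dim (V + C2) = n - (k + s + c)\<close> elements.
\<close>

section \<open>Additive characters of finite fields\<close>

lemma prime_CHAR_finite: "prime CHAR('a::{finite,field})"
  by (rule prime_CHAR_semidom) (simp add: finite_imp_CHAR_pos)

text \<open>For \<open>x\<close> nonzero, multiplication by \<open>x\<close> permutes the nonzero
  elements, so their product is unchanged by the factor \<open>x ^ (CARD('a) - 1)\<close>.\<close>

lemma power_CARD_eq: "(x::'a::{finite,field}) ^ CARD('a) = x"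
proof (cases "x = 0")
  case False
  let ?P = "\<Prod>y\<in>UNIV-{0::'a}. y"
  have "?P = (\<Prod>y\<in>UNIV-{0}. x * y)"
    by (rule prod.reindex_bij_witness[of _ "\<lambda>y. x * y" "\<lambda>y. y / x"]) (use False in auto)
  also have "\<dots> = x ^ (CARD('a) - 1) * ?P"
    by (simp add: prod.distrib)
  finally have "x ^ (CARD('a) - 1) = 1"
    by (simp add: prod_zero_iff)
  moreover have "CARD('a) = Suc (CARD('a) - 1)"
    by (simp add: zero_less_card_finite)
  ultimately show ?thesis
    by (metis mult.right_neutral power_Suc)
qed (simp add: zero_less_card_finite)

text \<open>An additive subgroup of maximal size among those of \<open>p\<close>-power order is the whole field: a
  missing element \<open>x\<close> would enlarge it by the factor \<open>p\<close>.\<close>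
lemma CARD_eq_CHAR_power: "\<exists>m. CHAR('a::{finite,field}) ^ m = CARD('a)"
proof -
  let ?p = "CHAR('a)"
  define S where "S = {H :: 'a set. 0 \<in> H \<and> (\<forall>x\<in>H. \<forall>y\<in>H. x + y \<in> H) \<and> (\<exists>m. card H = ?p ^ m)}"
  have p: "prime ?p" by (rule prime_CHAR_finite)
  have "{0} \<in> S"
    unfolding S_def by (auto intro: exI[of _ 0])
  then have "S \<noteq> {}" by blast
  moreover have "finite S" by simp
  ultimately have "Max (card ` S) \<in> card ` S" by (intro Max_in) auto
  then obtain H where H: "H \<in> S" and "card H = Max (card ` S)" by auto
  then have Hmax: "card H' \<le> card H" if "H' \<in> S" for H'
    using that \<open>finite S\<close> by simp
  have add: "x + y \<in> H" if "x \<in> H" "y \<in> H" for x y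
    using H that by (auto simp: S_def)
  have zero: "0 \<in> H" using H by (auto simp: S_def)
  obtain m where m: "card H = ?p ^ m" using H by (auto simp: S_def)
  have nsmul: "of_nat j * x \<in> H" if "x \<in> H" for j x
    by (induction j) (auto simp: zero add that distrib_right)
  have uminus: "- x \<in> H" if "x \<in> H" for x
  proof -
    \<comment> \<open>In characteristic \<open>p\<close> the integer \<open>p - 1\<close> acts as
      \<open>-1\<close>, so closure under addition already gives closure under negation.\<close>
    have "of_nat (?p - 1) * x = - x"
      using prime_gt_0_nat[OF p] by (simp add: of_nat_diff)
    then show ?thesis using nsmul[OF that, of "?p - 1"] by simp
  qed
  have "H = UNIV"
  proof (rule ccontr)
    assume "H \<noteq> UNIV"
    then obtain x where x: "x \<notin> H" by auto
    let ?f = "\<lambda>(j, h). of_nat j * x + h"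
    let ?H = "?f ` ({..<?p} \<times> H)"
    \<comment> \<open>A collision with \<open>j > j'\<close> puts \<open>(j - j') * x\<close> into
      \<open>H\<close>; since \<open>j - j'\<close> is invertible modulo \<open>p\<close>,
      \<open>x\<close> itself would lie in \<open>H\<close>.\<close>
    have key: "j \<le> j'" if "j < ?p" "j' < ?p" "h \<in> H" "h' \<in> H"
      "of_nat j * x + h = of_nat j' * x + h'" for j j' h h'
    proof (rule ccontr)
      assume "\<not> j \<le> j'"
      then have "of_nat (j - j') * x = h' + - h"
        using that(5) by (simp add: of_nat_diff algebra_simps)
      then have inH: "of_nat (j - j') * x \<in> H" using add[OF that(4) uminus[OF that(3)]] by simp
      have "\<not> ?p dvd (j - j')" using \<open>\<not> j \<le> j'\<close> that
        by (auto dest: dvd_imp_le)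
      then have "coprime (j - j') ?p" using p
        by (metis coprime_commute prime_imp_coprime)
      then obtain t where "[(j - j') * t = 1] (mod ?p)"
        by (metis cong_solve_coprime_nat One_nat_def)
      then have "of_nat ((j - j') * t) = (1::'a)"
        by (metis of_nat_eq_iff_cong_CHAR of_nat_1)
      then have "of_nat t * (of_nat (j - j') * x) = x"
        by (metis mult.assoc mult.commute mult_1 of_nat_mult)
      then show False using nsmul[OF inH, of t] x by metis
    qed
    have inj: "inj_on ?f ({..<?p} \<times> H)"
    proof (rule inj_onI, clarify)
      fix j h j' h'
      assume a: "j < ?p" "h \<in> H" "j' < ?p" "h' \<in> H" "of_nat j * x + h = of_nat j' * x + h'"
      then have "j = j'" using key[of j j' h h'] key[of j' j h' h] by auto
      then show "j = j' \<and> h = h'" using a by simp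
    qed
    have card: "card ?H = ?p ^ Suc m"
      using card_image[OF inj] m by (simp add: card_cartesian_product)
    have "?H \<in> S"
      unfolding S_def
    proof (intro CollectI conjI ballI)
      have "?f (0, 0) \<in> ?H" using zero prime_gt_0_nat[OF p] by (intro imageI) auto
      then show "0 \<in> ?H" by simp
      show "\<exists>m. card ?H = ?p ^ m" using card by blast
      fix u v assume "u \<in> ?H" "v \<in> ?H"
      then obtain j h j' h' where *: "h \<in> H" "h' \<in> H" "u = of_nat j * x + h" "v = of_nat j' * x + h'"
        by auto
      have "of_nat ((j + j') mod ?p) = (of_nat (j + j') :: 'a)"
        by (metis of_nat_eq_iff_cong_CHAR cong_mod_left cong_refl)
      then have "u + v = ?f ((j + j') mod ?p, h + h')"
        using * by (simp add: algebra_simps)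
      moreover have "((j + j') mod ?p, h + h') \<in> {..<?p} \<times> H"
        using * add prime_gt_0_nat[OF p] by simp
      ultimately show "u + v \<in> ?H" by (rule image_eqI)
    qed
    then have "card ?H \<le> card H" by (rule Hmax)
    then have "?p ^ Suc m \<le> ?p ^ m" by (simp only: card m)
    then show False using prime_gt_1_nat[OF p] by simp
  qed
  then show ?thesis using m by metis
qed

section \<open>The absolute trace and its values in the prime field\<close>

definition field_deg :: "'a::{finite,field} itself \<Rightarrow> nat" where
  "field_deg _ = (THE m. CHAR('a) ^ m = CARD('a))"

lemma CHAR_power_field_deg: "CHAR('a::{finite,field}) ^ field_deg TYPE('a) = CARD('a)"
  unfolding field_deg_def
proof (rule theI')
  show "\<exists>!m. CHAR('a) ^ m = CARD('a)"
    using CARD_eq_CHAR_power[where 'a='a] prime_gt_1_nat[OF prime_CHAR_finite[where 'a='a]]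
    by (metis power_inject_exp)
qed

lemma abs_trace_eq:
  "abs_trace (x::'a::{finite,field}) = (\<Sum>i<field_deg TYPE('a). x ^ (CHAR('a) ^ i))"
  by (simp add: abs_trace_def field_deg_def)

lemma abs_trace_add: "abs_trace (x + y) = abs_trace x + abs_trace y"
  by (simp add: abs_trace_eq freshmans_dream'[OF prime_CHAR_finite refl] sum.distrib)

text \<open>Frobenius moves each summand of the trace to the next one, and the last returns to the
  first because \<open>x ^ CARD('a) = x\<close>; the sum is only permuted.\<close>

lemma abs_trace_power_CHAR: "abs_trace (x::'a::{finite,field}) ^ CHAR('a) = abs_trace x"
proof -
  let ?p = "CHAR('a)" and ?m = "field_deg TYPE('a)"
  have "abs_trace x ^ ?p = (\<Sum>i<?m. x ^ (?p ^ Suc i))"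
    by (simp add: abs_trace_eq freshmans_dream_sum[OF prime_CHAR_finite refl] mult.commute
        flip: power_mult)
  also have "\<dots> + x ^ (?p ^ 0) = (\<Sum>i<Suc ?m. x ^ (?p ^ i))"
    by (simp only: sum.lessThan_Suc_shift add.commute)
  also have "\<dots> = abs_trace x + x"
    by (simp add: abs_trace_eq CHAR_power_field_deg power_CARD_eq)
  finally show ?thesis by simp
qed

text \<open>The polynomial \<open>X^p - X\<close> has at most \<open>p\<close> roots, and the
  \<open>p\<close> distinct residues \<open>of_nat j\<close> are already roots. Applied to a trace
  value, this yields the integer exponent that \<open>addchar\<close> needs.\<close>

lemma power_CHAR_eq_selfE:
  assumes "(t::'a::{finite,field}) ^ CHAR('a) = t"
  obtains j where "t = of_nat j"
proof -
  let ?p = "CHAR('a)"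
  let ?P = "monom 1 ?p - monom 1 1 :: 'a poly"
  have p: "?p > 1" by (rule prime_gt_1_nat[OF prime_CHAR_finite])
  have fix_of_nat: "(of_nat j :: 'a) ^ ?p = of_nat j" for j
  proof (induction j)
    case 0
    then show ?case using p by simp
  next
    case (Suc j)
    then show ?case by (simp add: freshmans_dream[OF prime_CHAR_finite refl])
  qed
  have "coeff ?P ?p = 1" using p by simp
  then have nz: "?P \<noteq> 0" by (metis coeff_0 zero_neq_one)
  have deg: "degree ?P \<le> ?p"
    using p by (intro degree_diff_le) (auto simp: degree_monom_eq)
  have sub: "of_nat ` {..<?p} \<subseteq> {x. poly ?P x = 0}"
    by (auto simp: poly_monom fix_of_nat)
  have inj: "inj_on (of_nat :: nat \<Rightarrow> 'a) {..<?p}"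
    by (auto simp: inj_on_def of_nat_eq_iff_cong_CHAR cong_def)
  have "card {x. poly ?P x = 0} \<le> card (of_nat ` {..<?p} :: 'a set)"
    using card_poly_roots_bound[OF nz] deg by (simp add: card_image[OF inj])
  then have "of_nat ` {..<?p} = {x. poly ?P x = 0}"
    using sub by (intro card_seteq) auto
  moreover have "poly ?P t = 0" using assms by (simp add: poly_monom)
  ultimately show ?thesis using that by blast
qed

section \<open>Roots of unity and the additive character\<close>

lemma cis_of_nat_cong:
  assumes "[i = j] (mod p)" "p > 0"
  shows "cis (2 * pi * real i / real p) = cis (2 * pi * real j / real p)"
proof -
  have *: "cis (2 * pi * real i / real p) = cis (2 * pi * real (i mod p) / real p)" for i
  proof -
    have "real i = real (i mod p) + real (i div p) * real p"
      by (metis add.commute div_mult_mod_eq of_nat_add of_nat_mult)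
    then have "2 * pi * real i / real p = 2 * pi * real (i mod p) / real p + 2 * pi * real (i div p)"
      using assms(2) by (simp add: field_simps)
    then show ?thesis
      by (simp add: cis_mult[symmetric] cis_multiple_2pi)
  qed
  show ?thesis
    using *[of i] *[of j] assms(1) by (simp add: cong_def)
qed

text \<open>Two integer representatives of the trace agree modulo the characteristic and
  \<open>cis\<close> has the matching period, so any of them may replace the \<open>LEAST\<close> in
  \<open>addchar\<close>.\<close>

lemma addchar_eqI:
  assumes "of_nat j = abs_trace (x::'a::{finite,field})"
  shows "addchar x = cis (2 * pi * real j / real CHAR('a))"
proof -
  let ?l = "LEAST j. (of_nat j :: 'a) = abs_trace x"
  have "(of_nat ?l :: 'a) = of_nat j"
    using LeastI[of "\<lambda>j. (of_nat j :: 'a) = abs_trace x", OF assms] assms by simp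
  then have "[?l = j] (mod CHAR('a))"
    by (simp add: of_nat_eq_iff_cong_CHAR)
  then show ?thesis
    unfolding addchar_def
    by (intro cis_of_nat_cong) (auto simp: prime_gt_0_nat[OF prime_CHAR_finite])
qed

lemma addchar_add: "addchar (x + y) = addchar x * addchar (y::'a::{finite,field})"
proof -
  obtain i where i: "abs_trace x = of_nat i"
    using power_CHAR_eq_selfE[OF abs_trace_power_CHAR] .
  obtain j where j: "abs_trace y = of_nat j"
    using power_CHAR_eq_selfE[OF abs_trace_power_CHAR] .
  have "of_nat (i + j) = abs_trace (x + y)" by (simp add: abs_trace_add i j)
  then show ?thesis
    by (simp add: addchar_eqI[of "i + j"] addchar_eqI[OF i[symmetric]] addchar_eqI[OF j[symmetric]]
        cis_mult distrib_left add_divide_distrib)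
qed

lemma addchar_nonzero [simp]: "addchar x \<noteq> 0"
  by (simp add: addchar_def)

lemma addchar_0 [simp]: "addchar 0 = 1"
  using addchar_add[of 0 0] by simp

text \<open>Both sides are inverse to \<open>addchar x\<close>: one because the modulus is one, the
  other by additivity.\<close>

lemma cnj_addchar: "cnj (addchar x) = addchar (- x)"
proof -
  have "addchar x * addchar (- x) = 1"
    by (simp flip: addchar_add)
  moreover have "addchar x * cnj (addchar x) = 1"
    by (simp add: addchar_def cis_cnj cis_mult)
  ultimately show ?thesis
    by (metis addchar_nonzero mult_left_cancel)
qed

text \<open>As a polynomial of degree \<open>CARD('a) / CHAR('a)\<close>, the trace cannot vanish everywhere.\<close>
lemma addchar_nontrivial: "\<exists>x::'a::{finite,field}. addchar x \<noteq> 1"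
proof -
  let ?p = "CHAR('a)" and ?m = "field_deg TYPE('a)"
  let ?P = "\<Sum>i<?m. monom 1 (?p ^ i) :: 'a poly"
  have p: "?p > 1" by (rule prime_gt_1_nat[OF prime_CHAR_finite])
  have "?m \<noteq> 0"
  proof
    assume "?m = 0"
    then have "CARD('a) = 1" using CHAR_power_field_deg[where 'a='a] by simp
    then show False
      by (metis card_1_singletonE singletonD UNIV_I zero_neq_one)
  qed
  then obtain m' where m': "?m = Suc m'" by (cases ?m) auto
  have "coeff ?P (?p ^ m') = (\<Sum>i<?m. if i = m' then 1 else 0)"
    using p by (auto simp: coeff_sum intro!: sum.cong)
  also have "\<dots> = 1" by (simp add: m')
  finally have nz: "?P \<noteq> 0" by (metis coeff_0 zero_neq_one)
  have "degree ?P \<le> ?p ^ m'"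
    using p by (intro degree_sum_le) (auto simp: m' degree_monom_eq intro: power_increasing)
  also have "\<dots> < ?p ^ ?m" using p by (simp add: m')
  finally have "card {x. poly ?P x = 0} < CARD('a)"
    using card_poly_roots_bound[OF nz] CHAR_power_field_deg[where 'a='a] by simp
  then have "{x. poly ?P x = 0} \<noteq> UNIV" by (metis less_irrefl)
  then obtain x where "poly ?P x \<noteq> 0" by auto
  then have x: "abs_trace x \<noteq> 0" by (simp add: abs_trace_eq poly_sum poly_monom)
  obtain j where j: "abs_trace x = of_nat j"
    using power_CHAR_eq_selfE[OF abs_trace_power_CHAR] .
  have "addchar x \<noteq> 1"
  proof
    assume "addchar x = 1"
    then have "cis (2 * pi * real j / real ?p) = cis 0"
      using addchar_eqI[OF j[symmetric]] by simp
    then have "cos (2 * pi * real j / real ?p) = 1"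
      by (metis cis.sel(1) cos_zero)
    then obtain k :: int where "2 * pi * real j / real ?p = of_int k * 2 * pi"
      by (auto simp: cos_one_2pi_int)
    then have "real j = of_int k * real ?p"
      using p by (simp add: field_simps)
    then have "int j = k * int ?p"
      by (metis of_int_eq_iff of_int_mult of_int_of_nat_eq)
    then have "?p dvd j" by (metis dvd_triv_right int_dvd_int_iff)
    then show False using x j by (simp add: of_nat_eq_0_iff_char_dvd)
  qed
  then show ?thesis by blast
qed

text \<open>A nonzero \<open>a\<close> may itself have trivial character, but its multiples run
  through the whole field. This turns a nonzero pairing into a nontrivial phase.\<close>

lemma exists_addchar_mult_neq_1:
  assumes "(a::'a::{finite,field}) \<noteq> 0"
  shows "\<exists>t. addchar (t * a) \<noteq> 1"
proof -
  obtain x :: 'a where "addchar x \<noteq> 1" using addchar_nontrivial by blast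
  then show ?thesis using assms by (intro exI[of _ "x / a"]) simp
qed

section \<open>Linear codes, duality and adapted bases\<close>

text \<open>All functions form one ambient space, so codes of every length, on the sender alone or
  with the receiver, are subspaces of it and share one theory of bases.\<close>

interpretation W: vector_space "cscale :: 'a::field \<Rightarrow> 'a word \<Rightarrow> 'a word"
  by unfold_locales (auto simp: cscale_def fun_eq_iff algebra_simps)

lemma cscale_apply [simp]: "cscale c v i = c * v i"
  by (simp add: cscale_def)

section \<open>Words, duality and character sums\<close>

definition words_on :: "nat set \<Rightarrow> ('a::zero) word set" where
  "words_on J = {v. \<forall>i. i \<notin> J \<longrightarrow> v i = 0}"

lemma Fn_eq_words_on: "Fn n = words_on {..<n}"
  by (auto simp: Fn_def words_on_def not_less)

lemma bij_betw_words_on_PiE: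
  "bij_betw (\<lambda>v. restrict v J) (words_on J :: ('a::zero) word set) (J \<rightarrow>\<^sub>E UNIV)"
  by (rule bij_betw_byWitness[where f' = "\<lambda>v i. if i \<in> J then v i else 0"])
    (auto simp: words_on_def fun_eq_iff PiE_def extensional_def)

lemma card_words_on:
  "finite J \<Longrightarrow> card (words_on J :: ('a::{finite,zero}) word set) = CARD('a) ^ card J"
  using bij_betw_same_card[OF bij_betw_words_on_PiE[where 'a='a]] by (simp add: card_funcsetE)

lemma finite_Fn [simp]: "finite (Fn n :: ('a::{finite,zero}) word set)"
  using bij_betw_finite[OF bij_betw_words_on_PiE[where 'a='a and J="{..<n}"]]
  by (simp add: Fn_eq_words_on finite_PiE)

lemma card_Fn: "card (Fn n :: ('a::{finite,zero}) word set) = CARD('a) ^ n"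
  by (simp add: Fn_eq_words_on card_words_on)

lemma subspace_Fn: "W.subspace (Fn n)"
  by (auto simp: W.subspace_def Fn_def)

lemma linear_code_iff: "linear_code n C \<longleftrightarrow> C \<subseteq> Fn n \<and> W.subspace C"
  by (auto simp: linear_code_def W.subspace_def)

lemma linear_codeD:
  assumes "linear_code n C"
  shows "C \<subseteq> Fn n" "W.subspace C" "finite (C :: ('a::{finite,field}) word set)"
  using assms by (auto simp: linear_code_iff intro: finite_subset[OF _ finite_Fn])

lemma linear_code_Fn: "linear_code n (Fn n)"
  by (simp add: linear_code_iff subspace_Fn)

lemma linear_code_dual: "linear_code n (dual_code n C)"
  unfolding linear_code_iff W.subspace_def
  by (auto simp: dual_code_def Fn_def distrib_right sum.distrib mult.assoc simp flip: sum_distrib_left)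

lemma dual_codeD: "y \<in> dual_code n C \<Longrightarrow> c \<in> C \<Longrightarrow> (\<Sum>i<n. y i * c i) = 0"
  by (auto simp: dual_code_def)

lemma bij_betw_add_subspace:
  assumes "W.subspace C" "g \<in> C"
  shows "bij_betw (\<lambda>x. x + g) C C"
  by (rule bij_betw_byWitness[where f' = "\<lambda>x. x - g"])
    (use assms in \<open>auto intro: W.subspace_add W.subspace_diff\<close>)

text \<open>Orthogonality of characters: off the dual, translation by a suitable codeword multiplies
  the sum by a factor different from one, which forces it to vanish.\<close>

lemma sum_addchar_code:
  fixes C :: "('a::{finite,field}) word set"
  assumes C: "linear_code n C" and y: "y \<in> Fn n"
  shows "(\<Sum>c\<in>C. addchar (\<Sum>i<n. y i * c i)) = (if y \<in> dual_code n C then of_nat (card C) else 0)"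
proof (cases "y \<in> dual_code n C")
  case True
  then show ?thesis by (simp add: dual_codeD)
next
  case False
  then obtain c where c: "c \<in> C" "(\<Sum>i<n. y i * c i) \<noteq> 0"
    using y by (auto simp: dual_code_def)
  obtain t where t: "addchar (t * (\<Sum>i<n. y i * c i)) \<noteq> 1"
    using exists_addchar_mult_neq_1[OF c(2)] by blast
  define g where "g = cscale t c"
  have g: "g \<in> C" using c C by (auto simp: g_def linear_code_def)
  have chi: "addchar (\<Sum>i<n. y i * g i) \<noteq> 1"
    using t by (simp add: g_def sum_distrib_left mult_ac)
  let ?S = "\<Sum>c\<in>C. addchar (\<Sum>i<n. y i * c i)"
  have "?S = (\<Sum>c\<in>C. addchar (\<Sum>i<n. y i * (c + g) i))"
    by (rule sum.reindex_bij_betw[OF bij_betw_add_subspace[OF linear_codeD(2)[OF C] g], symmetric])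
  also have "\<dots> = ?S * addchar (\<Sum>i<n. y i * g i)"
    by (simp add: distrib_left sum.distrib addchar_add sum_distrib_right)
  finally have "?S = 0 \<or> addchar (\<Sum>i<n. y i * g i) = 1" by (simp only: mult_cancel_left1)
  then show ?thesis using False chi by simp
qed

lemma dual_Fn: "dual_code n (Fn n) = {0 :: ('a::field) word}"
proof -
  have "y = 0" if y: "y \<in> dual_code n (Fn n)" for y :: "'a word"
  proof
    fix i
    show "y i = 0 i"
    proof (cases "i < n")
      case True
      have "(\<lambda>j. if j = i then 1 else 0) \<in> Fn n" using True by (auto simp: Fn_def)
      from dual_codeD[OF y this] True show ?thesis
        by (simp add: if_distrib[of "(*) _"] cong: if_cong)
    next
      case False
      then show ?thesis using y by (auto simp: dual_code_def Fn_def)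
    qed
  qed
  moreover have "0 \<in> dual_code n (Fn n)"
    using linear_code_dual[of n "Fn n"] by (auto simp: linear_code_def)
  ultimately show ?thesis by blast
qed

text \<open>Double counting: characters are summed over all pairs of a word of \<open>Fn n\<close>
  and a codeword, and orthogonality evaluates the inner sum in either order, once for
  \<open>C\<close> and once for the whole space.\<close>

lemma card_dual_code:
  fixes C :: "('a::{finite,field}) word set"
  assumes C: "linear_code n C"
  shows "card C * card (dual_code n C) = CARD('a) ^ n"
proof -
  let ?D = "dual_code n C"
  have D: "?D \<subseteq> Fn n" using linear_codeD(1)[OF linear_code_dual] .
  have "of_nat (card C * card ?D) = (\<Sum>y\<in>?D. of_nat (card C) :: complex)"
    by simp
  also have "\<dots> = (\<Sum>y\<in>Fn n. if y \<in> ?D then of_nat (card C) else 0)"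
    using D by (simp add: sum.If_cases Int_absorb1)
  also have "\<dots> = (\<Sum>y\<in>Fn n. \<Sum>c\<in>C. addchar (\<Sum>i<n. y i * c i))"
    by (simp add: sum_addchar_code[OF C] cong: sum.cong)
  also have "\<dots> = (\<Sum>c\<in>C. \<Sum>y\<in>Fn n. addchar (\<Sum>i<n. y i * c i))"
    by (rule sum.swap)
  also have "\<dots> = (\<Sum>c\<in>C. \<Sum>y\<in>Fn n. addchar (\<Sum>i<n. c i * y i))"
    by (simp add: mult.commute)
  also have "\<dots> = (\<Sum>c\<in>C. if c = 0 then of_nat (CARD('a) ^ n) else 0)"
    using linear_codeD(1)[OF C]
    by (intro sum.cong) (auto simp: sum_addchar_code[OF linear_code_Fn] dual_Fn card_Fn)
  also have "\<dots> = of_nat (CARD('a) ^ n)"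
    using linear_codeD(3)[OF C] C by (simp add: linear_code_def)
  finally show ?thesis by (simp only: of_nat_eq_iff)
qed

text \<open>One inclusion is symmetry of the pairing; equality follows because
  \<open>card_dual_code\<close>, used for \<open>C\<close> and for its dual, gives both sets the
  same size.\<close>

lemma dual_dual_code:
  fixes C :: "('a::{finite,field}) word set"
  assumes C: "linear_code n C"
  shows "dual_code n (dual_code n C) = C"
proof -
  have "C \<subseteq> dual_code n (dual_code n C)"
    using linear_codeD(1)[OF C] by (auto simp: dual_code_def mult.commute)
  moreover have "card (dual_code n C) * card (dual_code n (dual_code n C)) = card (dual_code n C) * card C"
    using card_dual_code[OF C] card_dual_code[OF linear_code_dual[of n C]] by (simp add: mult.commute)
  moreover have "card (dual_code n C) \<noteq> 0"
    using card_dual_code[OF C] by (metis mult_0_right power_not_zero zero_less_card_finite less_irrefl)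
  ultimately show ?thesis
    using card_seteq[OF linear_codeD(3)[OF linear_code_dual]] by (metis mult_left_cancel order_refl)
qed

section \<open>Coordinates with respect to a basis\<close>

definition comb :: "(nat \<Rightarrow> ('a::field) word) \<Rightarrow> nat set \<Rightarrow> 'a word \<Rightarrow> 'a word" where
  "comb f J x = (\<Sum>i\<in>J. cscale (x i) (f i))"

lemma comb_add: "comb f J (x + y) = comb f J x + comb f J y"
  by (simp add: comb_def W.scale_left_distrib sum.distrib)

lemma comb_cscale: "comb f J (cscale t x) = cscale t (comb f J x)"
  by (simp add: comb_def W.scale_sum_right)

lemma comb_mono:
  "finite J \<Longrightarrow> I \<subseteq> J \<Longrightarrow> x \<in> words_on I \<Longrightarrow> comb f J x = comb f I x"
  unfolding comb_def by (rule sum.mono_neutral_right) (auto simp: words_on_def)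

text \<open>Independence gives a trivial kernel, and a finite span consists of all linear
  combinations. For a basis of \<open>Fn n\<close> the inverse of this bijection is the coordinate
  map \<open>M\<close> used later.\<close>

lemma bij_betw_comb:
  assumes J: "finite J" and inj: "inj_on f J" and ind: "W.independent (f ` J)"
  shows "bij_betw (comb f J) (words_on J) (W.span (f ` J))"
proof (rule bij_betw_imageI)
  have zero: "x = 0" if "x \<in> words_on J" "comb f J x = 0" for x
  proof
    fix i
    show "x i = 0 i"
    proof (cases "i \<in> J")
      case True
      have "(\<Sum>v\<in>f ` J. cscale (x (inv_into J f v)) v) = 0"
        using that(2) by (simp add: sum.reindex[OF inj] comb_def inj)
      then have "x (inv_into J f (f i)) = 0"
        using W.independentD[OF ind finite_imageI[OF J] subset_refl, of "\<lambda>v. x (inv_into J f v)"] True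
        by blast
      then show ?thesis using True inj by simp
    next
      case False
      then show ?thesis using that(1) by (simp add: words_on_def)
    qed
  qed
  show "inj_on (comb f J) (words_on J)"
  proof (rule inj_onI)
    fix x y :: "'a word" assume *: "x \<in> words_on J" "y \<in> words_on J" "comb f J x = comb f J y"
    have "comb f J (x - y) + comb f J y = comb f J x" by (simp flip: comb_add)
    then have "comb f J (x - y) = 0" using * by simp
    moreover have "x - y \<in> words_on J" using * by (auto simp: words_on_def)
    ultimately have "x - y = 0" by (rule zero[rotated])
    then show "x = y" by simp
  qed
  show "comb f J ` words_on J = W.span (f ` J)"
  proof (intro equalityI subsetI)
    fix w assume "w \<in> comb f J ` words_on J"
    then show "w \<in> W.span (f ` J)"
      unfolding comb_def by (auto intro: W.span_sum W.span_scale W.span_base)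
  next
    fix w assume "w \<in> W.span (f ` J)"
    then obtain u where u: "w = (\<Sum>v\<in>f ` J. cscale (u v) v)"
      using W.span_finite[OF finite_imageI[OF J], of f] by auto
    define x where "x i = (if i \<in> J then u (f i) else 0)" for i
    have "w = comb f J x"
      by (simp add: u sum.reindex[OF inj] comb_def x_def)
    moreover have "x \<in> words_on J"
      by (simp add: words_on_def x_def)
    ultimately show "w \<in> comb f J ` words_on J" by blast
  qed
qed

lemma card_span_independent:
  fixes B :: "('a::{finite,field}) word set"
  assumes "finite B" "W.independent B"
  shows "card (W.span B) = CARD('a) ^ card B"
proof -
  obtain f where f: "bij_betw f {0..<card B} B"
    using ex_bij_betw_nat_finite[OF assms(1)] by blast
  then have "inj_on f {0..<card B}" "f ` {0..<card B} = B"
    by (auto simp: bij_betw_def)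
  then show ?thesis
    using bij_betw_same_card[OF bij_betw_comb[of "{0..<card B}" f]] assms(2)
    by (simp add: card_words_on)
qed

text \<open>Converts dimensions to cardinalities, so that later dimension counts become comparisons
  of powers of \<open>CARD('a)\<close>.\<close>

lemma card_code:
  fixes C :: "('a::{finite,field}) word set"
  assumes "linear_code n C"
  shows "card C = CARD('a) ^ code_dim C"
proof -
  obtain B where B: "B \<subseteq> C" "W.independent B" "C \<subseteq> W.span B" "card B = W.dim C"
    using W.basis_exists by blast
  have "W.span B = C"
    using B linear_codeD(2)[OF assms] by (metis W.span_minimal subset_antisym)
  moreover have "finite B" using B(1) linear_codeD(3)[OF assms] finite_subset by blast
  ultimately show ?thesis
    using card_span_independent[of B] B by (simp add: code_dim_def)
qed

lemma CARD_gt_1: "CARD('a::{finite,field}) > 1"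
proof -
  have "card {0, 1::'a} \<le> CARD('a)" by (rule card_mono) auto
  then show ?thesis by simp
qed

text \<open>Suppose a new \<open>e\<close> equals \<open>a + w\<close> with \<open>a\<close> in
  \<open>A\<close> and \<open>w\<close> in the span of \<open>E\<close>. Then
  \<open>a = e - w\<close> lies in both \<open>A\<close> and \<open>B\<close>, hence in the span of
  \<open>B0\<close>, and \<open>e\<close> would depend on the other elements of
  \<open>BB\<close>.\<close>

lemma independent_Un_Int:
  assumes A: "W.subspace A" "BA \<subseteq> A" "W.independent BA" "A \<subseteq> W.span BA"
    and B: "W.subspace B" "BB \<subseteq> B" "W.independent BB"
    and B0: "B0 \<subseteq> BB" "A \<inter> B \<subseteq> W.span B0"
    and E: "finite E" "E \<subseteq> BB - B0"
  shows "W.independent (BA \<union> E)"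
  using E
proof (induction E rule: finite_induct)
  case empty
  show ?case unfolding Un_empty_right by (rule A(3))
next
  case (insert e E)
  have "e \<notin> W.span (BA \<union> E)"
  proof
    assume "e \<in> W.span (BA \<union> E)"
    then obtain a w where aw: "e = a + w" "a \<in> W.span BA" "w \<in> W.span E"
      by (auto simp: W.span_Un)
    have "a \<in> A" using aw(2) A by (meson W.span_minimal subsetD)
    moreover have "w \<in> B"
      using aw(3) B insert.prems by (meson W.span_minimal subsetD insert_subset Diff_subset subset_trans)
    then have "a \<in> B"
      using aw(1) B insert.prems W.subspace_diff[OF B(1), of e w] by auto
    ultimately have "a \<in> W.span B0" using B0 by auto
    then have "e \<in> W.span (B0 \<union> E)"
      using aw by (auto simp: W.span_Un)
    moreover have "B0 \<union> E \<subseteq> BB - {e}" using insert B0 by auto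
    ultimately have "e \<in> W.span (BB - {e})" using W.span_mono by blast
    then show False using B(3) insert.prems by (auto simp: W.dependent_def)
  qed
  then have "W.independent (insert e (BA \<union> E))"
    by (rule W.independent_insertI) (use insert in blast)
  then show ?case unfolding Un_insert_right .
qed

lemma ex_bij_betw_interval:
  assumes "finite X"
  shows "\<exists>f. bij_betw f {m..<m + card X} X"
  by (rule finite_same_card_bij) (use assms in auto)

text \<open>The basis is ordered in four blocks: \<open>BA - B0\<close>, \<open>B0\<close>, a
  completion to the ambient space, and \<open>E\<close>. The first two span \<open>A\<close>, the
  second and fourth span \<open>B\<close>; \<open>E\<close> comes last because
  \<open>ea_input\<close> keeps the sender's ebit halves at positions from \<open>n - c\<close>
  on.\<close>

lemma adapted_coordinates:
  fixes A B :: "('a::{finite,field}) word set"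
  assumes A: "linear_code n A" and B: "linear_code n B"
  obtains M k s c where "bij_betw M (Fn n) (Fn n)"
    "\<And>u v. u \<in> Fn n \<Longrightarrow> v \<in> Fn n \<Longrightarrow> M (u + v) = M u + M v"
    "\<And>t u. u \<in> Fn n \<Longrightarrow> M (cscale t u) = cscale t (M u)"
    "k + s + c \<le> n"
    "A = {y \<in> Fn n. \<forall>i\<ge>k + s. M y i = 0}"
    "B = {y \<in> Fn n. \<forall>i. i < k \<or> k + s \<le> i \<and> i < n - c \<longrightarrow> M y i = 0}"
    "card A = CARD('a) ^ (k + s)" "card B = CARD('a) ^ (s + c)"
    "card {a + b |a b. a \<in> A \<and> b \<in> B} = CARD('a) ^ (k + s + c)"
proof -
  note A' = linear_codeD[OF A] and B' = linear_codeD[OF B]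
  obtain B0 where B0: "B0 \<subseteq> A \<inter> B" "W.independent B0" "A \<inter> B \<subseteq> W.span B0"
    using W.maximal_independent_subset by blast
  obtain BA where BA: "B0 \<subseteq> BA" "BA \<subseteq> A" "W.independent BA" "A \<subseteq> W.span BA"
    using W.maximal_independent_subset_extend[of B0 A] B0 by auto
  obtain BB where BB: "B0 \<subseteq> BB" "BB \<subseteq> B" "W.independent BB" "B \<subseteq> W.span BB"
    using W.maximal_independent_subset_extend[of B0 B] B0 by auto
  define E where "E = BB - B0"
  have fin: "finite BA" "finite BB" "finite B0" "finite E"
    using A'(3) B'(3) BA BB by (auto simp: E_def intro: finite_subset)
  have indE: "W.independent (BA \<union> E)"
    by (rule independent_Un_Int[OF A'(2) BA(2,3,4) B'(2) BB(2,3,1) B0(3) fin(4)]) (simp add: E_def)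
  have "BA \<union> E \<subseteq> Fn n" using A' B' BA BB by (auto simp: E_def)
  then obtain D where D: "BA \<union> E \<subseteq> D" "D \<subseteq> Fn n" "W.independent D" "Fn n \<subseteq> W.span D"
    using W.maximal_independent_subset_extend[of "BA \<union> E" "Fn n"] indE by auto
  have finD: "finite D" using D(2) finite_subset finite_Fn by blast
  have spanD: "W.span D = Fn n" using D subspace_Fn W.span_minimal by blast
  have spanA: "W.span BA = A" using BA A'(2) W.span_minimal by blast
  have spanB: "W.span BB = B" using BB B'(2) W.span_minimal by blast
  have disj: "BA \<inter> E = {}"
  proof -
    \<comment> \<open>An element of both sets lies in \<open>A\<close> and \<open>B\<close>, so it
      is in the span of \<open>B0\<close>, which independence of \<open>BB\<close> excludes for
      elements of \<open>E\<close>.\<close>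
    have "e \<notin> E" if "e \<in> BA" for e
    proof
      assume e: "e \<in> E"
      then have "e \<in> A \<inter> B" using that BA BB by (auto simp: E_def)
      then have "e \<in> W.span B0" using B0 by auto
      moreover have "B0 \<subseteq> BB - {e}" using e BB by (auto simp: E_def)
      ultimately have "e \<in> W.span (BB - {e})" using W.span_mono by blast
      then show False using BB(3) e by (auto simp: W.dependent_def E_def)
    qed
    then show ?thesis by blast
  qed
  define k s c r where "k = card (BA - B0)" "s = card B0" "c = card E" "r = card (D - (BA \<union> E))"
  note defs = this
  have ks: "k + s = card BA"
    using fin BA(1) by (simp add: defs card_Diff_subset card_mono)
  have sc: "s + c = card BB"
    using fin BB(1) by (simp add: defs E_def card_Diff_subset card_mono)
  have ksc: "k + s + c = card (BA \<union> E)"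
    using fin disj ks by (simp add: card_Un_disjoint defs)
  \<comment> \<open>The size of the ambient basis is found by counting its span.\<close>
  have "CARD('a) ^ card D = CARD('a) ^ n"
    using card_span_independent[OF finD D(3)] spanD by (simp add: card_Fn)
  then have "card D = n" using CARD_gt_1[where 'a='a] by simp
  then have n: "k + s + r + c = n"
    using ksc D(1) finD fin card_mono[OF finD D(1)] by (simp add: defs card_Diff_subset)
  obtain f1 where f1: "bij_betw f1 {0..<0 + k} (BA - B0)"
    using ex_bij_betw_interval[of "BA - B0" 0] fin by (auto simp: defs)
  obtain f2 where f2: "bij_betw f2 {k..<k + s} B0"
    using ex_bij_betw_interval[of B0 k] fin by (auto simp: defs)
  obtain f3 where f3: "bij_betw f3 {k+s..<k + s + r} (D - (BA \<union> E))"
    using ex_bij_betw_interval[of "D - (BA \<union> E)" "k + s"] finD by (auto simp: defs)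
  obtain f4 where f4: "bij_betw f4 {k+s+r..<k + s + r + c} E"
    using ex_bij_betw_interval[of E "k + s + r"] fin by (auto simp: defs)
  define f where "f i = (if i < k then f1 i else if i < k + s then f2 i
      else if i < k + s + r then f3 i else f4 i)" for i
  have g1: "bij_betw f {0..<k} (BA - B0)"
    using f1 by (subst bij_betw_cong[of _ _ f1]) (auto simp: f_def)
  have g2: "bij_betw f {k..<k + s} B0"
    using f2 by (subst bij_betw_cong[of _ _ f2]) (auto simp: f_def)
  have g3: "bij_betw f {k+s..<k + s + r} (D - (BA \<union> E))"
    using f3 by (subst bij_betw_cong[of _ _ f3]) (auto simp: f_def)
  have g4: "bij_betw f {k+s+r..<n} E"
    using f4 n by (subst bij_betw_cong[of _ _ f4]) (auto simp: f_def)
  have h1: "bij_betw f ({0..<k} \<union> {k..<k+s}) ((BA - B0) \<union> B0)"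
    by (rule bij_betw_combine[OF g1 g2]) auto
  have h2: "bij_betw f ({k..<k+s} \<union> {k+s+r..<n}) (B0 \<union> E)"
    by (rule bij_betw_combine[OF g2 g4]) (auto simp: E_def)
  have h3: "bij_betw f (({0..<k} \<union> {k..<k+s}) \<union> {k+s+r..<n}) (((BA - B0) \<union> B0) \<union> E)"
    by (rule bij_betw_combine[OF h1 g4]) (use BA(1) disj in auto)
  have h4: "bij_betw f ((({0..<k} \<union> {k..<k+s}) \<union> {k+s+r..<n}) \<union> {k+s..<k + s + r})
      ((((BA - B0) \<union> B0) \<union> E) \<union> (D - (BA \<union> E)))"
    by (rule bij_betw_combine[OF h3 g3]) (use BA(1) in auto)
  have "(({0..<k} \<union> {k..<k+s}) \<union> {k+s+r..<n}) \<union> {k+s..<k + s + r} = {..<n}"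
    using n by auto
  moreover have "(((BA - B0) \<union> B0) \<union> E) \<union> (D - (BA \<union> E)) = D" using D BA by auto
  ultimately have fD: "bij_betw f {..<n} D" using h4 by metis
  have fA: "f ` {..<k+s} = BA"
  proof -
    have "{0..<k} \<union> {k..<k+s} = {..<k+s}" by auto
    moreover have "(BA - B0) \<union> B0 = BA" using BA by auto
    ultimately show ?thesis using h1 by (metis bij_betw_imp_surj_on)
  qed
  have fB: "f ` ({k..<k+s} \<union> {k+s+r..<n}) = BB"
  proof -
    have "B0 \<union> E = BB" using BB by (auto simp: E_def)
    then show ?thesis using h2 by (metis bij_betw_imp_surj_on)
  qed
  have inj: "inj_on f {..<n}" and img: "f ` {..<n} = D" using fD by (auto simp: bij_betw_def)
  let ?L = "comb f {..<n}"
  have L: "bij_betw ?L (Fn n) (Fn n)"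
    using bij_betw_comb[of "{..<n}" f] inj img D(3) spanD by (simp add: Fn_eq_words_on)
  have Lsub: "?L ` words_on J = W.span (f ` J)" if J: "J \<subseteq> {..<n}" for J
  proof -
    have "W.independent (f ` J)" using D(3) img J W.independent_mono by blast
    then have "comb f J ` words_on J = W.span (f ` J)"
      by (intro bij_betw_imp_surj_on bij_betw_comb inj_on_subset[OF inj J] finite_subset[OF J]) simp
    moreover have "?L ` words_on J = comb f J ` words_on J"
      by (rule image_cong) (use J in \<open>auto intro: comb_mono\<close>)
    ultimately show ?thesis by simp
  qed
  define M where "M = inv_into (Fn n) ?L"
  have M: "bij_betw M (Fn n) (Fn n)" unfolding M_def by (rule bij_betw_inv_into[OF L])
  have L_M: "?L (M y) = y" if "y \<in> Fn n" for y
    using that L unfolding M_def by (metis bij_betw_inv_into_right)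
  have M_L: "M (?L x) = x" if "x \<in> Fn n" for x
    using that L unfolding M_def by (metis bij_betw_inv_into_left)
  have MF: "M y \<in> Fn n" if "y \<in> Fn n" for y using that M by (metis bij_betwE)
  have LF: "?L y \<in> Fn n" if "y \<in> Fn n" for y using that L by (metis bij_betwE)
  \<comment> \<open>Membership in the span of a part of the basis is vanishing of the other
    coordinates; applied to two unions of blocks this describes \<open>A\<close> and
    \<open>B\<close>.\<close>
  have Mchar: "W.span (f ` J) = {y \<in> Fn n. M y \<in> words_on J}" if J: "J \<subseteq> {..<n}" for J
  proof -
    have JF: "(words_on J :: 'a word set) \<subseteq> Fn n" using J by (auto simp: words_on_def Fn_def)
    have "?L ` words_on J = {y \<in> Fn n. M y \<in> words_on J}"
    proof (intro equalityI subsetI)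
      fix y assume "y \<in> ?L ` words_on J"
      then obtain x where "x \<in> words_on J" "y = ?L x" by blast
      then show "y \<in> {y \<in> Fn n. M y \<in> words_on J}" using JF M_L LF by auto
    next
      fix y assume "y \<in> {y \<in> Fn n. M y \<in> words_on J}"
      then have "y = ?L (M y)" "M y \<in> words_on J" by (simp_all add: L_M)
      then show "y \<in> ?L ` words_on J" by blast
    qed
    then show ?thesis using Lsub[OF J] by simp
  qed
  show thesis
  proof (rule that[of M k s c, OF M])
    fix u v :: "'a word" assume uv: "u \<in> Fn n" "v \<in> Fn n"
    have "u + v = ?L (M u + M v)" using uv by (simp add: comb_add L_M)
    moreover have "M u + M v \<in> Fn n" using uv MF W.subspace_add[OF subspace_Fn] by blast
    ultimately show "M (u + v) = M u + M v" using M_L by simp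
  next
    fix t and u :: "'a word" assume u: "u \<in> Fn n"
    have "cscale t u = ?L (cscale t (M u))" using u by (simp add: comb_cscale L_M)
    moreover have "cscale t (M u) \<in> Fn n" using u MF W.subspace_scale[OF subspace_Fn] by blast
    ultimately show "M (cscale t u) = cscale t (M u)" using M_L by simp
  next
    show "k + s + c \<le> n" using n by simp
    show "A = {y \<in> Fn n. \<forall>i\<ge>k + s. M y i = 0}"
      using Mchar[of "{..<k+s}"] fA spanA n by (auto simp: words_on_def not_less)
    have "B = {y \<in> Fn n. M y \<in> words_on ({k..<k+s} \<union> {k+s+r..<n})}"
      by (rule Mchar[of "{k..<k+s} \<union> {k+s+r..<n}", unfolded fB spanB]) (use n in auto)
    also have "\<dots> = {y \<in> Fn n. \<forall>i. i < k \<or> k + s \<le> i \<and> i < n - c \<longrightarrow> M y i = 0}"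
    proof (rule Collect_cong, rule conj_cong[OF refl])
      fix y :: "'a word" assume "y \<in> Fn n"
      then have z: "M y i = 0" if "i \<ge> n" for i using MF that by (auto simp: Fn_def)
      \<comment> \<open>Beyond position \<open>n\<close> the coordinates vanish by \<open>z\<close>,
        which accounts for the extra case here.\<close>
      have "i \<notin> {k..<k+s} \<union> {k+s+r..<n} \<longleftrightarrow> (i < k \<or> k + s \<le> i \<and> i < n - c) \<or> i \<ge> n" for i
        using n by auto
      then show "M y \<in> words_on ({k..<k+s} \<union> {k+s+r..<n}) \<longleftrightarrow>
          (\<forall>i. i < k \<or> k + s \<le> i \<and> i < n - c \<longrightarrow> M y i = 0)"
        using z unfolding words_on_def mem_Collect_eq by blast
    qed
    finally show "B = {y \<in> Fn n. \<forall>i. i < k \<or> k + s \<le> i \<and> i < n - c \<longrightarrow> M y i = 0}" .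
    show "card A = CARD('a) ^ (k + s)"
      using card_span_independent[OF fin(1) BA(3)] spanA ks by simp
    show "card B = CARD('a) ^ (s + c)"
      using card_span_independent[OF fin(2) BB(3)] spanB sc by simp
    have "{a + b |a b. a \<in> A \<and> b \<in> B} = W.span (BA \<union> BB)"
      using spanA spanB by (auto simp: W.span_Un)
    also have "BA \<union> BB = BA \<union> E" using BA by (auto simp: E_def)
    finally show "card {a + b |a b. a \<in> A \<and> b \<in> B} = CARD('a) ^ (k + s + c)"
      using card_span_independent[OF finite_UnI[OF fin(1,4)] indE] ksc by metis
  qed
qed

section \<open>Cyclic codes\<close>

definition word_poly :: "nat \<Rightarrow> ('a::field) word \<Rightarrow> 'a poly" where
  "word_poly n c = (\<Sum>j<n. monom (c j) j)"

lemma coeff_word_poly: "coeff (word_poly n c) i = (if i < n then c i else 0)"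
  by (simp add: word_poly_def coeff_sum)

lemma coeff_word_poly_Fn: "c \<in> Fn n \<Longrightarrow> coeff (word_poly n c) = c"
  by (auto simp: coeff_word_poly Fn_def fun_eq_iff)

lemma word_poly_coeff: "coeff p \<in> Fn n \<Longrightarrow> word_poly n (coeff p) = p"
  by (auto simp: poly_eq_iff coeff_word_poly Fn_def)

text \<open>For \<open>n = 0\<close> the zero polynomial would break the equivalence, since its
  degree is 0.\<close>

lemma degree_less_iff_Fn: "n \<ge> 1 \<Longrightarrow> degree p < n \<longleftrightarrow> coeff p \<in> Fn n"
  unfolding Fn_def mem_Collect_eq
  by (auto intro: coeff_eq_0 degree_lessI)

lemma field_hom_0: "field_hom emb \<Longrightarrow> emb 0 = 0"
  unfolding field_hom_def by (metis add_cancel_right_right)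

lemma field_hom_diff: "field_hom emb \<Longrightarrow> emb (x - y) = emb x - emb y"
  unfolding field_hom_def by (metis add_diff_cancel_right' diff_add_cancel)

lemma field_hom_eq_0_iff: "field_hom emb \<Longrightarrow> emb x = 0 \<longleftrightarrow> x = 0"
  using field_hom_0[of emb] unfolding field_hom_def
  by (metis mult_zero_left right_inverse zero_neq_one)

lemma map_poly_hom_add:
  assumes "field_hom emb"
  shows "map_poly emb (p + q) = map_poly emb p + map_poly emb q"
  by (rule poly_eqI) (use assms in \<open>simp add: coeff_map_poly field_hom_0 field_hom_def\<close>)

lemma map_poly_hom_mult:
  assumes "field_hom emb"
  shows "map_poly emb (p * q) = map_poly emb p * map_poly emb q"
proof -
  note emb0 = field_hom_0[OF assms]
  have smult: "map_poly emb (smult c p) = smult (emb c) (map_poly emb p)" for c p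
    by (rule poly_eqI) (use assms in \<open>simp add: coeff_map_poly emb0 field_hom_def\<close>)
  show ?thesis
    by (induction p) (simp_all add: map_poly_pCons emb0 map_poly_hom_add[OF assms] smult)
qed

lemma degree_map_poly_hom: "field_hom emb \<Longrightarrow> degree (map_poly emb p) = degree p"
  by (rule degree_map_poly) (simp add: field_hom_eq_0_iff)

lemma cw_eval_coeff:
  assumes "field_hom emb" "coeff p \<in> Fn n"
  shows "cw_eval emb n (coeff p) \<beta> = poly (map_poly emb p) \<beta>"
proof -
  note emb0 = field_hom_0[OF assms(1)]
  have "poly (map_poly emb p) \<beta> = (\<Sum>i\<le>degree p. emb (coeff p i) * \<beta> ^ i)"
    by (simp add: poly_altdef degree_map_poly_hom[OF assms(1)] coeff_map_poly emb0)
  also have "\<dots> = (\<Sum>i\<in>{..degree p} \<union> {..<n}. emb (coeff p i) * \<beta> ^ i)"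
    by (rule sum.mono_neutral_left) (auto simp: emb0 coeff_eq_0)
  also have "\<dots> = (\<Sum>i<n. emb (coeff p i) * \<beta> ^ i)"
    by (rule sum.mono_neutral_right) (use assms(2) in \<open>auto simp: Fn_def emb0\<close>)
  finally show ?thesis by (simp add: cw_eval_def)
qed

lemma primitive_root_power_inj:
  assumes "primitive_root_of_unity n (\<alpha>::'b::field)" "n \<ge> 1"
  shows "inj_on (\<lambda>i. \<alpha> ^ i) {..<n}"
proof (rule linorder_inj_onI)
  fix i j :: nat
  assume ij: "i < j" "i \<in> {..<n}" "j \<in> {..<n}"
  have "\<alpha> \<noteq> 0"
    using assms by (auto simp: primitive_root_of_unity_def power_0_left)
  have "\<alpha> ^ (j - i) \<noteq> 1" using assms(1) ij by (auto simp: primitive_root_of_unity_def)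
  then show "\<alpha> ^ i \<noteq> \<alpha> ^ j"
    using ij(1) \<open>\<alpha> \<noteq> 0\<close> by (metis less_imp_le_nat mult_cancel_left1 power_add le_add_diff_inverse power_not_zero)
qed auto

section \<open>Cyclic codes as ideals and their generators\<close>

abbreviation xn1 :: "nat \<Rightarrow> 'a::field poly" where
  "xn1 n \<equiv> monom 1 n - 1"

lemma degree_xn1: "n \<ge> 1 \<Longrightarrow> degree (xn1 n :: 'a::field poly) = n"
  using degree_add_eq_left[of "-1 :: 'a poly" "monom 1 n"] by (simp add: degree_monom_eq)

lemma coeff_mod_xn1: "n \<ge> 1 \<Longrightarrow> coeff (p mod xn1 n) \<in> Fn n"
  using degree_mod_less[of "xn1 n" p] degree_xn1[of n, where 'a='a]
  by (metis degree_less_iff_Fn degree_0 less_le_trans less_one not_less)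

text \<open>Modulo \<open>X^n - 1\<close>, multiplication by \<open>X\<close> is the cyclic shift:
  the coefficient pushed to \<open>X^n\<close> returns as the constant term.\<close>

lemma coeff_pCons_mod_xn1:
  assumes n: "n \<ge> 1"
  shows "coeff (pCons 0 p mod xn1 n) = cshift n (coeff (p mod xn1 n))"
proof -
  define r where "r = p mod xn1 n"
  define c where "c = coeff r (n - 1)"
  define w where "w = pCons 0 r - smult c (xn1 n)"
  have rF: "coeff r \<in> Fn n" unfolding r_def by (rule coeff_mod_xn1[OF n])
  have "pCons 0 p mod xn1 n = ([:0, 1:] * p) mod xn1 n" by simp
  also have "\<dots> = ([:0, 1:] * r) mod xn1 n"
    unfolding r_def by (rule mod_mult_right_eq[symmetric])
  also have "\<dots> = (w + [:c:] * xn1 n) mod xn1 n"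
    by (simp add: w_def)
  also have "\<dots> = w mod xn1 n" by (rule mod_mult_self1)
  finally have *: "pCons 0 p mod xn1 n = w mod xn1 n" .
  have w: "coeff w = cshift n (coeff r)"
  proof
    fix i
    consider "i = 0" | "0 < i" "i < n" | "i = n" | "i > n" by linarith
    then show "coeff w i = cshift n (coeff r) i"
    proof cases
      case 1
      then show ?thesis using n by (simp add: w_def cshift_def c_def)
    next
      case 2
      then obtain j where j: "i = Suc j" by (cases i) auto
      then have "(i + n - 1) mod n = j" using 2 by simp
      then show ?thesis using 2 j by (simp add: w_def cshift_def)
    next
      case 3
      then obtain j where "i = Suc j" using n by (cases i) auto
      then show ?thesis using 3 n by (simp add: w_def cshift_def c_def)
    next
      case 4
      then obtain j where j: "i = Suc j" by (cases i) auto
      then have "coeff r j = 0" using 4 rF by (auto simp: Fn_def)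
      then show ?thesis using 4 j by (simp add: w_def cshift_def)
    qed
  qed
  then have "coeff w \<in> Fn n" by (auto simp: Fn_def cshift_def)
  then have "degree w < n" using degree_less_iff_Fn n by blast
  then have "w mod xn1 n = w" using degree_xn1[OF n, where 'a='a] by (intro mod_poly_less) simp
  then show ?thesis using * w by (simp add: r_def)
qed

text \<open>The polynomials with residue in \<open>D\<close> form an ideal: shift closure gives
  multiplication by \<open>X\<close>, linearity the rest. By division with remainder, a nonzero
  element of least degree generates it. The generator is not normalised to be monic.\<close>

lemma cyclic_code_generator:
  fixes D :: "('a::{finite,field}) word set"
  assumes n: "n \<ge> 1" and D: "cyclic_code n D"
  obtains g where "g \<noteq> 0" "\<And>p. g dvd p \<longleftrightarrow> coeff (p mod xn1 n) \<in> D"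
proof -
  define I where "I = {p. coeff (p mod xn1 n) \<in> D}"
  have lin: "linear_code n D" and shift: "\<And>v. v \<in> D \<Longrightarrow> cshift n v \<in> D"
    using D by (auto simp: cyclic_code_def)
  note sub = linear_codeD(2)[OF lin]
  have add: "p + q \<in> I" if "p \<in> I" "q \<in> I" for p q
  proof -
    have "coeff ((p + q) mod xn1 n) = coeff (p mod xn1 n) + coeff (q mod xn1 n)"
      by (simp add: poly_mod_add_left fun_eq_iff)
    then show ?thesis using that W.subspace_add[OF sub] by (simp add: I_def)
  qed
  have smult: "smult t p \<in> I" if "p \<in> I" for p t
  proof -
    have "coeff (smult t p mod xn1 n) = cscale t (coeff (p mod xn1 n))"
      by (simp add: mod_smult_left fun_eq_iff)
    then show ?thesis using that W.subspace_scale[OF sub] by (simp add: I_def)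
  qed
  have zero: "0 \<in> I"
  proof -
    have "coeff (0::'a poly) = 0" by (simp add: fun_eq_iff)
    then show ?thesis using W.subspace_0[OF sub] by (simp add: I_def)
  qed
  have mult: "q * p \<in> I" if "p \<in> I" for p q
  proof (induction q)
    case 0
    then show ?case using zero by simp
  next
    case (pCons a q)
    then have "pCons 0 (q * p) \<in> I" using shift by (simp add: I_def coeff_pCons_mod_xn1[OF n])
    then show ?case using add[OF smult[OF that]] by simp
  qed
  \<comment> \<open>This provides a nonzero element of the ideal even when \<open>D\<close> is the
    zero code.\<close>
  have xI: "xn1 n \<in> I"
  proof -
    have "coeff (0::'a poly) = 0" by (simp add: fun_eq_iff)
    then show ?thesis using W.subspace_0[OF sub] by (simp add: I_def)
  qed
  moreover have "xn1 n \<noteq> (0 :: 'a poly)" using degree_xn1[OF n, where 'a='a] n by (metis degree_0 not_one_le_zero)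
  ultimately have "\<exists>g. (g \<in> I \<and> g \<noteq> 0) \<and> (\<forall>h. h \<in> I \<and> h \<noteq> 0 \<longrightarrow> degree g \<le> degree h)"
    by (intro ex_has_least_nat) auto
  then obtain g where g: "g \<in> I" "g \<noteq> 0" and gmin: "\<And>h. h \<in> I \<Longrightarrow> h \<noteq> 0 \<Longrightarrow> degree g \<le> degree h"
    by blast
  have "g dvd p" if "p \<in> I" for p
  proof -
    have "p mod g = p + smult (-1) ((p div g) * g)"
      by (simp add: minus_div_mult_eq_mod[symmetric])
    then have "p mod g \<in> I" using add smult mult that g by metis
    then have "p mod g = 0" using gmin degree_mod_less[OF g(2), of p] by force
    then show ?thesis by (simp add: mod_eq_0_iff_dvd)
  qed
  moreover have "p \<in> I" if "g dvd p" for p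
    using that mult[OF g(1)] by (metis dvdE mult.commute)
  ultimately show thesis using that[of g] g(2) by (auto simp: I_def)
qed

text \<open>The codewords are the multiples \<open>g * u\<close> with the coefficients of
  \<open>u\<close> below position \<open>n - degree g\<close>, and the defining set consists of the
  exponents at which \<open>g\<close> vanishes. It remains to see that \<open>g\<close> has
  \<open>degree g\<close> roots among the powers of \<open>\<alpha>\<close>.\<close>

lemma card_cyclic_code_defining_set:
  fixes D :: "('a::{finite,field}) word set" and emb :: "'a \<Rightarrow> 'b::field"
  assumes n: "n \<ge> 1" and D: "cyclic_code n D" and emb: "field_hom emb"
    and \<alpha>: "primitive_root_of_unity n \<alpha>"
  shows "card D * CARD('a) ^ card (defining_set emb \<alpha> n D) = CARD('a) ^ n"
proof -
  obtain g where g0: "g \<noteq> 0" and g: "\<And>p. g dvd p \<longleftrightarrow> coeff (p mod xn1 n) \<in> D"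
    using cyclic_code_generator[OF n D] by blast
  let ?e = "map_poly emb"
  have lin: "linear_code n D" using D by (auto simp: cyclic_code_def)
  note DF = linear_codeD(1)[OF lin]
  have x0: "xn1 n \<noteq> (0 :: 'a poly)" using degree_xn1[OF n, where 'a='a] n by (metis degree_0 not_one_le_zero)
  have "coeff (0::'a poly) = 0" by (simp add: fun_eq_iff)
  then have "g dvd xn1 n" using W.subspace_0[OF linear_codeD(2)[OF lin]] by (simp add: g)
  then obtain h where h: "xn1 n = g * h" by (elim dvdE)
  have h0: "h \<noteq> 0" using x0 h by auto
  have deg: "degree g + degree h = n"
    using degree_mult_eq[OF g0 h0] degree_xn1[OF n, where 'a='a] h by simp
  have modF: "p mod xn1 n = p" if "coeff p \<in> Fn n" for p :: "'a poly"
    using that n degree_less_iff_Fn[of n p] degree_xn1[OF n, where 'a='a] by (intro mod_poly_less) simp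
  let ?m = "n - degree g"
  have "bij_betw (\<lambda>v. coeff (g * word_poly ?m v)) (Fn ?m) D"
  proof (rule bij_betw_imageI)
    show "inj_on (\<lambda>v. coeff (g * word_poly ?m v)) (Fn ?m)"
      by (rule inj_onI) (metis coeff_inject mult_cancel_left g0 coeff_word_poly_Fn)
    show "(\<lambda>v. coeff (g * word_poly ?m v)) ` Fn ?m = D"
    proof (intro equalityI subsetI)
      fix c assume "c \<in> (\<lambda>v. coeff (g * word_poly ?m v)) ` Fn ?m"
      then obtain v where c: "c = coeff (g * word_poly ?m v)" and v: "v \<in> Fn ?m" by blast
      have "c \<in> Fn n"
      proof (cases "word_poly ?m v = 0")
        case True
        then show ?thesis by (simp add: c Fn_def)
      next
        case False
        then have "degree (word_poly ?m v) < ?m"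
          by (metis coeff_word_poly leading_coeff_0_iff)
        then have "degree (g * word_poly ?m v) < n"
          using degree_mult_le[of g "word_poly ?m v"] by linarith
        then show ?thesis using degree_less_iff_Fn n c by blast
      qed
      then show "c \<in> D" using g[of "g * word_poly ?m v"] modF c by simp
    next
      fix c assume cD: "c \<in> D"
      define p where "p = word_poly n c"
      have cp: "coeff p = c" using cD DF by (auto simp: p_def coeff_word_poly_Fn)
      then have "g dvd p" using g modF cD DF by auto
      then obtain u where u: "p = g * u" by (elim dvdE)
      have "coeff u \<in> Fn ?m"
        unfolding Fn_def
      proof (intro CollectI allI impI, rule ccontr)
        fix i assume i: "?m \<le> i" "coeff u i \<noteq> 0"
        then have "u \<noteq> 0" "i \<le> degree u" by (auto intro: le_degree)
        then have "degree p \<ge> n" using degree_mult_eq[OF g0] i deg by (simp add: u)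
        moreover have "degree p < n" using degree_less_iff_Fn[OF n, of p] cp cD DF by auto
        ultimately show False by simp
      qed
      then have "c = coeff (g * word_poly ?m (coeff u))" by (simp add: word_poly_coeff cp flip: u)
      then show "c \<in> (\<lambda>v. coeff (g * word_poly ?m v)) ` Fn ?m"
        using \<open>coeff u \<in> Fn ?m\<close> by blast
    qed
  qed
  then have cardD: "card D = CARD('a) ^ ?m"
    using bij_betw_same_card card_Fn by metis
  have xroot: "poly (?e (xn1 n)) (\<alpha> ^ i) = 0" for i
  proof -
    have "?e (xn1 n) = xn1 n"
      using emb by (intro poly_eqI)
        (auto simp: coeff_map_poly field_hom_0 field_hom_diff field_hom_def)
    moreover have "(\<alpha> ^ i) ^ n = 1"
      using \<alpha> by (metis power_mult mult.commute power_one primitive_root_of_unity_def)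
    ultimately show ?thesis by (simp add: poly_monom)
  qed
  let ?Z = "\<lambda>f. {i. i < n \<and> poly (?e f) (\<alpha> ^ i) = 0}"
  have "defining_set emb \<alpha> n D = ?Z g"
    unfolding defining_set_def
  proof (rule Collect_cong, rule conj_cong[OF refl], rule iffI)
    fix i assume *: "\<forall>c\<in>D. cw_eval emb n c (\<alpha> ^ i) = 0"
    \<comment> \<open>For the zero code \<open>g\<close> has degree \<open>n\<close> and is not the
      polynomial of a codeword, so its remainder is evaluated instead; \<open>xn1 n\<close> vanishes
      at the powers of \<open>\<alpha>\<close>.\<close>
    have "?e (g mod xn1 n + xn1 n * (g div xn1 n)) = ?e g" by (simp only: mod_mult_div_eq)
    then have "?e g = ?e (g mod xn1 n) + ?e (xn1 n) * ?e (g div xn1 n)"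
      by (simp only: map_poly_hom_add[OF emb] map_poly_hom_mult[OF emb])
    then have "poly (?e g) (\<alpha> ^ i) = poly (?e (g mod xn1 n)) (\<alpha> ^ i)"
      by (simp only: poly_add poly_mult xroot mult_zero_left add_0_right)
    also have "\<dots> = cw_eval emb n (coeff (g mod xn1 n)) (\<alpha> ^ i)"
      by (rule cw_eval_coeff[OF emb coeff_mod_xn1[OF n], symmetric])
    also have "\<dots> = 0" using * g[of g] by auto
    finally show "poly (?e g) (\<alpha> ^ i) = 0" .
  next
    fix i assume *: "poly (?e g) (\<alpha> ^ i) = 0"
    show "\<forall>c\<in>D. cw_eval emb n c (\<alpha> ^ i) = 0"
    proof
      fix c assume cD: "c \<in> D"
      then have cp: "coeff (word_poly n c) = c" using DF by (auto simp: coeff_word_poly_Fn)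
      then have "g dvd word_poly n c" using g modF cD DF by auto
      then obtain u where u: "word_poly n c = g * u" by (elim dvdE)
      have "cw_eval emb n c (\<alpha> ^ i) = poly (?e (g * u)) (\<alpha> ^ i)"
        using cw_eval_coeff[OF emb, of "word_poly n c"] cp cD DF u by auto
      then show "cw_eval emb n c (\<alpha> ^ i) = 0" using * by (simp add: map_poly_hom_mult[OF emb])
    qed
  qed
  moreover have "card (?Z g) = degree g"
  proof -
    have bound: "card (?Z f) \<le> degree f" if "f \<noteq> 0" for f
    proof -
      have nz: "?e f \<noteq> 0" using that emb by (simp add: map_poly_eq_0_iff field_hom_eq_0_iff field_hom_0)
      have "card (?Z f) = card ((\<lambda>i. \<alpha> ^ i) ` ?Z f)"
        by (rule card_image[symmetric], rule inj_on_subset[OF primitive_root_power_inj[OF \<alpha> n]]) auto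
      also have "\<dots> \<le> card {x. poly (?e f) x = 0}"
        by (rule card_mono[OF poly_roots_finite[OF nz]]) auto
      also have "\<dots> \<le> degree f"
        using card_poly_roots_bound[OF nz] by (simp add: degree_map_poly_hom[OF emb])
      finally show ?thesis .
    qed
    \<comment> \<open>Each of the \<open>n\<close> powers is a root of \<open>g\<close> or of
      \<open>h\<close>. Neither factor has more roots than its degree and the degrees add up to
      \<open>n\<close>, so both bounds are attained.\<close>
    have "i \<in> ?Z g \<union> ?Z h" if "i < n" for i
      using xroot[of i] that by (simp add: h map_poly_hom_mult[OF emb])
    then have "{..<n} \<subseteq> ?Z g \<union> ?Z h" by blast
    then have "card {..<n} \<le> card (?Z g \<union> ?Z h)" by (intro card_mono) auto
    also have "\<dots> \<le> card (?Z g) + card (?Z h)" by (rule card_Un_le)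
    finally have "n \<le> card (?Z g) + card (?Z h)" by simp
    then show ?thesis using bound[OF g0] bound[OF h0] deg by linarith
  qed
  ultimately show ?thesis using cardD deg by (simp flip: power_add)
qed

section \<open>Shifts, duals and sums of cyclic codes\<close>

lemma bij_betw_rotate:
  assumes "(n::nat) \<ge> 1"
  shows "bij_betw (\<lambda>i. (i + n - 1) mod n) {..<n} {..<n}"
proof (rule bij_betw_byWitness[where f' = "\<lambda>j. (j + 1) mod n"])
  show "\<forall>i\<in>{..<n}. ((i + n - 1) mod n + 1) mod n = i"
  proof
    fix i assume i: "i \<in> {..<n}"
    have "((i + n - 1) mod n + 1) mod n = (i + n - 1 + 1) mod n" by (rule mod_add_left_eq)
    also have "i + n - 1 + 1 = i + n" using assms by simp
    finally show "((i + n - 1) mod n + 1) mod n = i" using i by simp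
  qed
  show "\<forall>j\<in>{..<n}. ((j + 1) mod n + n - 1) mod n = j"
  proof
    fix j assume "j \<in> {..<n}"
    then show "((j + 1) mod n + n - 1) mod n = j"
      by (cases "j + 1 = n") auto
  qed
qed (use assms in auto)

lemma inj_on_cshift:
  assumes "n \<ge> 1"
  shows "inj_on (cshift n) (Fn n)"
proof (rule inj_onI, rule ext)
  fix u v :: "'a word" and j
  assume uv: "u \<in> Fn n" "v \<in> Fn n" "cshift n u = cshift n v"
  show "u j = v j"
  proof (cases "j < n")
    case True
    then obtain i where "i < n" "j = (i + n - 1) mod n"
      using bij_betw_imp_surj_on[OF bij_betw_rotate[OF assms]] by blast
    then show ?thesis using fun_cong[OF uv(3), of i] by (simp add: cshift_def)
  next
    case False
    then show ?thesis using uv by (simp add: Fn_def)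
  qed
qed

text \<open>The shift is injective on a finite code and so maps it onto itself: each codeword is the
  shift of a codeword, and rotating both words leaves their pairing unchanged.\<close>

lemma cyclic_code_dual:
  fixes C :: "('a::{finite,field}) word set"
  assumes n: "n \<ge> 1" and C: "cyclic_code n C"
  shows "cyclic_code n (dual_code n C)"
  unfolding cyclic_code_def
proof (intro conjI ballI linear_code_dual)
  fix v assume v: "v \<in> dual_code n C"
  have lin: "linear_code n C" and shift: "cshift n ` C \<subseteq> C"
    using C by (auto simp: cyclic_code_def)
  have surj: "cshift n ` C = C"
    using linear_codeD[OF lin] shift
    by (intro endo_inj_surj inj_on_subset[OF inj_on_cshift[OF n]]) auto
  have "(\<Sum>i<n. cshift n v i * c i) = 0" if "c \<in> C" for c
  proof -
    have "c \<in> cshift n ` C" unfolding surj by (rule that)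
    then obtain c' where c': "c' \<in> C" "c = cshift n c'" by (elim imageE)
    have "(\<Sum>i<n. cshift n v i * c i) = (\<Sum>i<n. (\<lambda>j. v j * c' j) ((i + n - 1) mod n))"
      by (rule sum.cong) (auto simp: c' cshift_def)
    also have "\<dots> = (\<Sum>j<n. v j * c' j)"
      by (rule sum.reindex_bij_betw[OF bij_betw_rotate[OF n]])
    finally show ?thesis using dual_codeD[OF v c'(1)] by simp
  qed
  then show "cshift n v \<in> dual_code n C"
    by (auto simp: dual_code_def Fn_def cshift_def)
qed

lemma cyclic_code_sum:
  assumes A: "cyclic_code n A" and B: "cyclic_code n B"
  shows "cyclic_code n {a + b |a b. a \<in> A \<and> b \<in> B}"
proof -
  have lin: "linear_code n A" "linear_code n B" using A B by (auto simp: cyclic_code_def)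
  then have sub: "W.subspace {a + b |a b. a \<in> A \<and> b \<in> B}"
    unfolding linear_code_iff by (intro W.subspace_sums) auto
  have F: "{a + b |a b. a \<in> A \<and> b \<in> B} \<subseteq> Fn n"
    using lin unfolding linear_code_iff by (blast intro: W.subspace_add[OF subspace_Fn])
  have "cshift n (a + b) = cshift n a + cshift n b" for a b :: "'a word"
    by (auto simp: cshift_def fun_eq_iff)
  then show ?thesis
    using A B sub F unfolding cyclic_code_def linear_code_iff by blast
qed

text \<open>Evaluation is additive, and setting one summand to zero recovers the condition for each
  code separately.\<close>

lemma defining_set_sum:
  assumes emb: "field_hom emb" and A: "linear_code n A" and B: "linear_code n B"
  shows "defining_set emb \<alpha> n {a + b |a b. a \<in> A \<and> b \<in> B}
    = defining_set emb \<alpha> n A \<inter> defining_set emb \<alpha> n B" (is "?l = ?r")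
proof (intro equalityI subsetI)
  have add: "cw_eval emb n (a + b) \<beta> = cw_eval emb n a \<beta> + cw_eval emb n b \<beta>" for a b \<beta>
    using emb by (simp add: cw_eval_def field_hom_def distrib_right sum.distrib)
  {
    fix i assume "i \<in> ?r"
    then show "i \<in> ?l" by (auto simp: defining_set_def add)
  next
    fix i assume i: "i \<in> ?l"
    then have z: "cw_eval emb n (a + b) (\<alpha> ^ i) = 0" if "a \<in> A" "b \<in> B" for a b
      using that unfolding defining_set_def by blast
    have "0 \<in> A" "0 \<in> B" using A B by (auto simp: linear_code_def)
    then show "i \<in> ?r"
      using i z[of _ 0] z[of 0] by (simp add: defining_set_def)
  }
qed

section \<open>Entanglement-assisted codes in adapted coordinates\<close>

lemma detectable_scalar_0: "(\<And>u v. u \<in> Q \<Longrightarrow> v \<in> Q \<Longrightarrow> inner_st N u (E v) = 0) \<Longrightarrow> detectable N Q E"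
  unfolding detectable_def by (intro exI[of _ 0]) simp

lemma restr_Fn: "restr n x \<in> Fn n"
  by (simp add: restr_def Fn_def)

lemma restr_id: "x \<in> Fn n \<Longrightarrow> restr n x = x"
  by (auto simp: restr_def Fn_def fun_eq_iff)

lemma restr_add: "restr n (x + y) = restr n x + restr n (y :: ('a::field) word)"
  by (auto simp: restr_def fun_eq_iff)

lemma restr_cscale: "restr n (cscale t x) = cscale t (restr n x)"
  by (auto simp: restr_def fun_eq_iff)

text \<open>The sender's qudits carry coordinates \<open>M y\<close>, divided into blocks of sizes \<open>k\<close> (information),
  \<open>s\<close> (ancillas rotated to a uniform superposition, giving X-type stabilizers),
  \<open>n - c - k - s\<close> (ancillas left at zero, giving Z-type stabilizers), and \<open>c\<close> (halves of ebits).\<close>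
locale ea_coordinates =
  fixes M :: "('a::{finite,field}) word \<Rightarrow> 'a word" and n k s c :: nat
  assumes M_bij: "bij_betw M (Fn n) (Fn n)"
    and M_add: "\<And>u v. u \<in> Fn n \<Longrightarrow> v \<in> Fn n \<Longrightarrow> M (u + v) = M u + M v"
    and M_scale: "\<And>t u. u \<in> Fn n \<Longrightarrow> M (cscale t u) = cscale t (M u)"
    and le_n: "k + s + c \<le> n"
begin

definition coords :: "'a word \<Rightarrow> 'a word" where
  "coords y = M (restr n y)"

text \<open>The labels of the basis states fixed by all Z-type stabilizers: zero ancillas in the
  third block, and equal values on both halves of each ebit.\<close>

definition zsupp :: "'a word set" where
  "zsupp = {y \<in> Fn (n + c). (\<forall>i. k + s \<le> i \<and> i < n - c \<longrightarrow> coords y i = 0)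
      \<and> (\<forall>j<c. coords y (n - c + j) = y (n + j))}"

text \<open>The translations of the X-type stabilizers; they move the second block freely and each
  ebit half together with its partner at the receiver.\<close>

definition xgroup :: "'a word set" where
  "xgroup = {y \<in> zsupp. \<forall>i<k. coords y i = 0}"

text \<open>A description free of encoder and operators, to which both the set of encoded states and
  the stabilizer eigenspace are compared.\<close>

definition codespace :: "'a state set" where
  "codespace = {\<psi> \<in> Hspace (n + c). (\<forall>y. y \<notin> zsupp \<longrightarrow> \<psi> y = 0) \<and> (\<forall>y. \<forall>g\<in>xgroup. \<psi> (y + g) = \<psi> y)}"

section \<open>Linearity of the coordinates, stabilizers and error detection\<close>

lemma coords_Fn: "coords y \<in> Fn n"
  using bij_betwE[OF M_bij] restr_Fn by (auto simp: coords_def)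

lemma coords_add: "coords (x + y) = coords x + coords y"
  by (simp only: coords_def restr_add M_add restr_Fn)

lemma coords_cscale: "coords (cscale t y) = cscale t (coords y)"
  by (simp only: coords_def restr_cscale M_scale restr_Fn)

lemma coords_0: "coords 0 = 0"
  using coords_add[of 0 0] by (simp del: plus_fun_apply)

lemma coords_diff: "coords (x - y) = coords x - coords y"
proof -
  have "coords (x - y) + coords y = coords x"
    using coords_add[of "x - y" y] by (simp only: diff_add_cancel)
  then show ?thesis by (simp only: eq_diff_eq)
qed

lemma linear_zsupp: "linear_code (n + c) zsupp"
  unfolding linear_code_iff W.subspace_def
proof (intro conjI ballI allI)
  show "zsupp \<subseteq> Fn (n + c)" by (auto simp: zsupp_def)
  show "0 \<in> zsupp" by (simp add: zsupp_def coords_0 Fn_def)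
  show "x + y \<in> zsupp" if "x \<in> zsupp" "y \<in> zsupp" for x y
    using that by (simp add: zsupp_def coords_add Fn_def)
  show "cscale t x \<in> zsupp" if "x \<in> zsupp" for x t
    using that by (simp add: zsupp_def coords_cscale Fn_def)
qed

lemma linear_xgroup: "linear_code (n + c) xgroup"
proof -
  note z = linear_codeD(1,2)[OF linear_zsupp]
  show ?thesis
    unfolding linear_code_iff W.subspace_def
  proof (intro conjI ballI allI)
    show "xgroup \<subseteq> Fn (n + c)" using z by (auto simp: xgroup_def)
    show "0 \<in> xgroup" using W.subspace_0[OF z(2)] by (simp add: xgroup_def coords_0)
    show "x + y \<in> xgroup" if "x \<in> xgroup" "y \<in> xgroup" for x y
      using that W.subspace_add[OF z(2)] by (simp add: xgroup_def coords_add)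
    show "cscale t x \<in> xgroup" if "x \<in> xgroup" for x t
      using that W.subspace_scale[OF z(2)] by (simp add: xgroup_def coords_cscale)
  qed
qed

lemma xgroup_subset: "xgroup \<subseteq> zsupp"
  by (auto simp: xgroup_def)

lemma zsupp_add_xgroup: "g \<in> xgroup \<Longrightarrow> y + g \<in> zsupp \<longleftrightarrow> y \<in> zsupp"
  using linear_codeD(2)[OF linear_zsupp] xgroup_subset
  by (metis W.subspace_add W.subspace_diff add_diff_cancel_right' subsetD)

text \<open>The X operators express invariance under \<open>xgroup\<close>. The Z operators express
  the support condition: by \<open>dual_dual_code\<close> a label outside \<open>zsupp\<close> pairs
  nontrivially with some element of the dual, and a multiple of that element gives a phase other
  than one, so the amplitude is zero.\<close>

lemma codespace_stabilizer:
  defines "S \<equiv> (\<lambda>a. (1, a, 0)) ` xgroup \<union> (\<lambda>b. (1, 0, b)) ` dual_code (n + c) zsupp"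
  shows "codespace = {\<psi> \<in> Hspace (n + c).
      \<forall>(ph, a, b)\<in>S. (\<lambda>y. ph * pauli (n + c) a b \<psi> y) = \<psi>}"
proof -
  have X: "pauli (n + c) g 0 \<psi> y = \<psi> (y - g)" if "\<psi> \<in> Hspace (n + c)" "g \<in> xgroup" for \<psi> g y
  proof (cases "y \<in> Fn (n + c)")
    case True
    then show ?thesis by (simp add: pauli_def)
  next
    case False
    moreover have g: "g \<in> Fn (n + c)" using that linear_codeD(1)[OF linear_xgroup] by blast
    ultimately have "y - g \<notin> Fn (n + c)"
      using W.subspace_add[OF subspace_Fn _ g] by (metis diff_add_cancel)
    then show ?thesis using False that by (simp add: pauli_def Hspace_def)
  qed
  have Z: "pauli (n + c) 0 b \<psi> y = addchar (\<Sum>i<n + c. b i * y i) * \<psi> y"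
    if "\<psi> \<in> Hspace (n + c)" for \<psi> b y
    using that by (simp add: pauli_def Hspace_def)
  show ?thesis
  proof (intro equalityI subsetI)
    fix \<psi> assume \<psi>: "\<psi> \<in> codespace"
    then have H: "\<psi> \<in> Hspace (n + c)" and out: "\<And>y. y \<notin> zsupp \<Longrightarrow> \<psi> y = 0"
      and inv: "\<And>y g. g \<in> xgroup \<Longrightarrow> \<psi> (y + g) = \<psi> y"
      by (auto simp: codespace_def)
    have "pauli (n + c) g 0 \<psi> y = \<psi> y" if "g \<in> xgroup" for g y
      using X[OF H that, of y] inv[OF that, of "y - g"] by (simp only: diff_add_cancel)
    moreover have "pauli (n + c) 0 b \<psi> y = \<psi> y" if b: "b \<in> dual_code (n + c) zsupp" for b y
    proof (cases "y \<in> zsupp")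
      case True
      then show ?thesis using Z[OF H] dual_codeD[OF b] by simp
    next
      case False
      then show ?thesis using Z[OF H] out by simp
    qed
    ultimately show "\<psi> \<in> {\<psi> \<in> Hspace (n + c).
        \<forall>(ph, a, b)\<in>S. (\<lambda>y. ph * pauli (n + c) a b \<psi> y) = \<psi>}"
      using H by (auto simp: S_def)
  next
    fix \<psi> assume "\<psi> \<in> {\<psi> \<in> Hspace (n + c).
        \<forall>(ph, a, b)\<in>S. (\<lambda>y. ph * pauli (n + c) a b \<psi> y) = \<psi>}"
    then have H: "\<psi> \<in> Hspace (n + c)"
      and stab: "\<And>ph a b. (ph, a, b) \<in> S \<Longrightarrow> (\<lambda>y. ph * pauli (n + c) a b \<psi> y) = \<psi>"
      by auto
    have inv: "\<psi> (y + g) = \<psi> y" if g: "g \<in> xgroup" for y g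
    proof -
      have "(1, g, 0) \<in> S" using g by (simp add: S_def)
      then have "pauli (n + c) g 0 \<psi> (y + g) = \<psi> (y + g)"
        using fun_cong[OF stab, of 1 g 0 "y + g"] by (simp only: mult_1)
      then show ?thesis using X[OF H g, of "y + g"] by (simp only: add_diff_cancel)
    qed
    have out: "\<psi> y = 0" if y: "y \<notin> zsupp" for y
    proof (cases "y \<in> Fn (n + c)")
      case True
      obtain b where b: "b \<in> dual_code (n + c) zsupp" "(\<Sum>i<n + c. y i * b i) \<noteq> 0"
        using y True dual_dual_code[OF linear_zsupp] unfolding dual_code_def[of _ "dual_code _ _"] by blast
      obtain t where t: "addchar (t * (\<Sum>i<n + c. y i * b i)) \<noteq> 1"
        using exists_addchar_mult_neq_1[OF b(2)] by blast
      have "cscale t b \<in> dual_code (n + c) zsupp"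
        by (rule W.subspace_scale[OF linear_codeD(2)[OF linear_code_dual] b(1)])
      then have "(1, 0, cscale t b) \<in> S" by (simp add: S_def)
      then have "pauli (n + c) 0 (cscale t b) \<psi> y = \<psi> y"
        using fun_cong[OF stab, of 1 0 "cscale t b" y] by (simp only: mult_1)
      moreover have "(\<Sum>i<n + c. cscale t b i * y i) = t * (\<Sum>i<n + c. y i * b i)"
        by (simp add: sum_distrib_left mult_ac)
      ultimately have "addchar (t * (\<Sum>i<n + c. y i * b i)) * \<psi> y = \<psi> y"
        using Z[OF H, of "cscale t b" y] by simp
      then show ?thesis using t by simp
    next
      case False
      then show ?thesis using H by (simp add: Hspace_def)
    qed
    show "\<psi> \<in> codespace" using H out inv by (simp add: codespace_def)
  qed
qed

text \<open>States of the code live on \<open>zsupp\<close>; the error moves this support to a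
  disjoint coset, so all inner products vanish.\<close>

lemma detectable_X:
  assumes a: "a \<notin> zsupp"
  shows "detectable (n + c) codespace (pauli (n + c) a b)"
proof (rule detectable_scalar_0)
  fix u v assume uv: "u \<in> codespace" "v \<in> codespace"
  have "u y = 0 \<or> v (y - a) = 0" for y
  proof (rule ccontr)
    assume "\<not> (u y = 0 \<or> v (y - a) = 0)"
    then have "y \<in> zsupp" "y - a \<in> zsupp" using uv by (auto simp: codespace_def)
    then have "y - (y - a) \<in> zsupp" using W.subspace_diff[OF linear_codeD(2)[OF linear_zsupp]] by blast
    moreover have "y - (y - a) = a" by (simp add: fun_eq_iff)
    ultimately show False using a by simp
  qed
  then show "inner_st (n + c) u (pauli (n + c) a b v) = 0"
    unfolding inner_st_def pauli_def by (intro sum.neutral ballI) auto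
qed

text \<open>Translating the summation variable by a multiple of a suitable element of
  \<open>xgroup\<close> fixes both states and multiplies the inner product by a nontrivial phase, so
  it is zero.\<close>

lemma detectable_Z:
  assumes b: "\<exists>g\<in>xgroup. (\<Sum>i<n + c. b i * g i) \<noteq> 0"
  shows "detectable (n + c) codespace (pauli (n + c) a b)"
proof (rule detectable_scalar_0)
  fix u v assume uv: "u \<in> codespace" "v \<in> codespace"
  obtain g0 where g0: "g0 \<in> xgroup" "(\<Sum>i<n + c. b i * g0 i) \<noteq> 0" using b by blast
  obtain t where t: "addchar (t * (\<Sum>i<n + c. b i * g0 i)) \<noteq> 1"
    using exists_addchar_mult_neq_1[OF g0(2)] by blast
  define g where "g = cscale t g0"
  have g: "g \<in> xgroup" using g0(1) linear_xgroup by (auto simp: g_def linear_code_def)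
  have gF: "g \<in> Fn (n + c)" using g linear_codeD(1)[OF linear_xgroup] by blast
  have chi: "addchar (\<Sum>i<n + c. b i * g i) \<noteq> 1"
    using t by (simp add: g_def sum_distrib_left mult_ac)
  have inv: "u (y + g) = u y" "v (y + g) = v y" for y
    using uv g by (auto simp: codespace_def)
  let ?F = "\<lambda>x. cnj (u x) * (addchar (\<Sum>i<n + c. b i * (x i - a i)) * v (x - a))"
  have eq: "inner_st (n + c) u (pauli (n + c) a b v) = (\<Sum>x\<in>Fn (n + c). ?F x)"
    by (simp add: inner_st_def pauli_def cong: sum.cong)
  have "(\<Sum>x\<in>Fn (n + c). ?F x) = (\<Sum>x\<in>Fn (n + c). ?F (x + g))"
    by (rule sum.reindex_bij_betw[OF bij_betw_add_subspace[OF subspace_Fn gF], symmetric])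
  also have "\<dots> = (\<Sum>x\<in>Fn (n + c). ?F x * addchar (\<Sum>i<n + c. b i * g i))"
  proof (rule sum.cong[OF refl])
    fix x
    have "(\<Sum>i<n + c. b i * ((x + g) i - a i)) = (\<Sum>i<n + c. b i * (x i - a i)) + (\<Sum>i<n + c. b i * g i)"
      by (simp add: sum.distrib[symmetric] algebra_simps)
    moreover have "x + g - a = (x - a) + g" by (simp add: fun_eq_iff)
    ultimately show "?F (x + g) = ?F x * addchar (\<Sum>i<n + c. b i * g i)"
      by (simp only: inv addchar_add mult_ac)
  qed
  also have "\<dots> = (\<Sum>x\<in>Fn (n + c). ?F x) * addchar (\<Sum>i<n + c. b i * g i)"
    by (simp only: sum_distrib_right)
  finally have "(\<Sum>x\<in>Fn (n + c). ?F x) = 0 \<or> addchar (\<Sum>i<n + c. b i * g i) = 1"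
    by (simp only: mult_cancel_left1)
  then show "inner_st (n + c) u (pauli (n + c) a b v) = 0" using chi eq by simp
qed

lemma detectable_identity: "detectable (n + c) codespace (pauli (n + c) 0 0)"
  unfolding detectable_def by (intro exI[of _ 1]) (simp add: inner_st_def pauli_def cong: sum.cong)

section \<open>The encoder: unitarity and image\<close>

definition fourier :: "'a word \<Rightarrow> 'a word \<Rightarrow> complex" where
  "fourier z x = (if \<forall>i<n. i \<notin> {k..<k + s} \<longrightarrow> z i = x i
     then addchar (\<Sum>i\<in>{k..<k + s}. x i * z i) / complex_of_real (sqrt (real CARD('a)) ^ s) else 0)"

text \<open>The Fourier transform acts first, on the second block only; then the basis state with
  coordinates \<open>M y\<close> is relabelled \<open>y\<close>, a permutation of the basis.\<close>

definition encoder :: "'a word \<Rightarrow> 'a word \<Rightarrow> complex" where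
  "encoder y x = fourier (M y) x"

text \<open>The permutation \<open>M\<close> drops out of the inner product of two columns. What
  remains is a character sum over the second block, evaluated by
  \<open>sum_addchar_code\<close>.\<close>

lemma unitary_encoder: "unitary_on n encoder"
  unfolding unitary_on_def
proof (intro ballI)
  fix x x' :: "'a word" assume x: "x \<in> Fn n" and x': "x' \<in> Fn n"
  let ?I = "{k..<k + s}"
  let ?K = "complex_of_real (sqrt (real CARD('a)) ^ s)"
  have "(\<Sum>y\<in>Fn n. cnj (encoder y x) * encoder y x') = (\<Sum>z\<in>Fn n. cnj (fourier z x) * fourier z x')"
    unfolding encoder_def by (rule sum.reindex_bij_betw[OF M_bij])
  also have "\<dots> = (if x = x' then 1 else 0)"
  proof (cases "\<forall>i<n. i \<notin> ?I \<longrightarrow> x i = x' i")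
    case False
    then have "(\<Sum>z\<in>Fn n. cnj (fourier z x) * fourier z x') = 0"
      by (intro sum.neutral) (auto simp: fourier_def)
    then show ?thesis using False by auto
  next
    case True
    \<comment> \<open>\<open>p\<close> is \<open>x\<close> with the second block erased; the labels
      \<open>z\<close> with a nonzero entry in column \<open>x\<close> are \<open>p\<close> plus
      words on that block.\<close>
    define p where "p i = (if i \<in> ?I then 0 else x i)" for i
    define d where "d = x' - x"
    have pF: "p \<in> Fn n" using x by (auto simp: p_def Fn_def)
    have IF: "?I \<subseteq> {..<n}" using le_n by auto
    have lin: "linear_code n (words_on ?I :: 'a word set)"
      unfolding linear_code_iff W.subspace_def using le_n by (auto simp: words_on_def Fn_def)
    have dF: "d \<in> Fn n" using x x' by (auto simp: d_def Fn_def)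
    have d0: "d i = 0" if "i \<notin> ?I" for i
    proof (cases "i < n")
      case True
      then show ?thesis using \<open>\<forall>i<n. _ i\<close> that by (simp add: d_def)
    next
      case False
      then show ?thesis using dF by (auto simp: Fn_def)
    qed
    have KK: "cnj ?K * ?K = of_nat (CARD('a) ^ s)"
    proof -
      have "cnj ?K * ?K = complex_of_real (sqrt (real CARD('a)) ^ s * sqrt (real CARD('a)) ^ s)"
        by (simp only: complex_cnj_complex_of_real of_real_mult)
      also have "sqrt (real CARD('a)) ^ s * sqrt (real CARD('a)) ^ s = real CARD('a) ^ s"
        by (simp flip: power_mult_distrib)
      finally show ?thesis by simp
    qed
    have "(\<Sum>z\<in>Fn n. cnj (fourier z x) * fourier z x')
        = (\<Sum>z\<in>(\<lambda>w. w + p) ` words_on ?I. cnj (fourier z x) * fourier z x')"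
    proof (rule sum.mono_neutral_right)
      show "(\<lambda>w. w + p) ` words_on ?I \<subseteq> Fn n"
        using pF linear_codeD(1)[OF lin] W.subspace_add[OF subspace_Fn] by blast
      show "\<forall>z\<in>Fn n - (\<lambda>w. w + p) ` words_on ?I. cnj (fourier z x) * fourier z x' = 0"
      proof
        fix z assume z: "z \<in> Fn n - (\<lambda>w. w + p) ` words_on ?I"
        have "fourier z x = 0"
        proof (rule ccontr)
          assume "fourier z x \<noteq> 0"
          then have agree: "\<forall>i<n. i \<notin> ?I \<longrightarrow> z i = x i" by (auto simp: fourier_def split: if_splits)
          have "z - p \<in> words_on ?I"
            unfolding words_on_def
          proof (intro CollectI allI impI)
            fix i assume "i \<notin> ?I"
            then show "(z - p) i = 0"
              using agree z x by (cases "i < n") (auto simp: p_def Fn_def)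
          qed
          then have "(z - p) + p \<in> (\<lambda>w. w + p) ` words_on ?I" by (rule imageI)
          then show False using z unfolding diff_add_cancel by blast
        qed
        then show "cnj (fourier z x) * fourier z x' = 0" by simp
      qed
    qed simp
    also have "\<dots> = (\<Sum>w\<in>words_on ?I. cnj (fourier (w + p) x) * fourier (w + p) x')"
      by (subst sum.reindex) (auto simp: inj_on_def)
    also have "\<dots> = (\<Sum>w\<in>words_on ?I. addchar (\<Sum>i<n. d i * w i) / of_nat (CARD('a) ^ s))"
    proof (rule sum.cong[OF refl])
      fix w :: "'a word" assume w: "w \<in> words_on ?I"
      have agree: "\<forall>i<n. i \<notin> ?I \<longrightarrow> (w + p) i = x i" using w by (auto simp: words_on_def p_def)
      have agree': "\<forall>i<n. i \<notin> ?I \<longrightarrow> (w + p) i = x' i" using agree True by auto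
      have sumI: "(\<Sum>i\<in>?I. v i * (w + p) i) = (\<Sum>i\<in>?I. v i * w i)" for v
        by (rule sum.cong) (auto simp: p_def)
      have "fourier (w + p) x = addchar (\<Sum>i\<in>?I. x i * w i) / ?K"
        unfolding fourier_def sumI by (rule if_P[OF agree])
      moreover have "fourier (w + p) x' = addchar (\<Sum>i\<in>?I. x' i * w i) / ?K"
        unfolding fourier_def sumI by (rule if_P[OF agree'])
      ultimately have "cnj (fourier (w + p) x) * fourier (w + p) x'
          = addchar (- (\<Sum>i\<in>?I. x i * w i)) * addchar (\<Sum>i\<in>?I. x' i * w i) / (cnj ?K * ?K)"
        by (simp only: complex_cnj_divide cnj_addchar times_divide_times_eq)
      also have "\<dots> = addchar (\<Sum>i\<in>?I. d i * w i) / of_nat (CARD('a) ^ s)"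
        unfolding KK
        by (simp add: d_def left_diff_distrib sum_subtractf flip: addchar_add)
      also have "(\<Sum>i\<in>?I. d i * w i) = (\<Sum>i<n. d i * w i)"
        by (rule sum.mono_neutral_left) (use IF d0 in auto)
      finally show "cnj (fourier (w + p) x) * fourier (w + p) x'
          = addchar (\<Sum>i<n. d i * w i) / of_nat (CARD('a) ^ s)" .
    qed
    also have "\<dots> = (\<Sum>w\<in>words_on ?I. addchar (\<Sum>i<n. d i * w i)) / of_nat (CARD('a) ^ s)"
      by (rule sum_divide_distrib[symmetric])
    also have "\<dots> = (if d \<in> dual_code n (words_on ?I) then 1 else 0)"
      by (simp add: sum_addchar_code[OF lin dF] card_words_on)
    also have "d \<in> dual_code n (words_on ?I) \<longleftrightarrow> x = x'"
    proof
      assume dd: "d \<in> dual_code n (words_on ?I)"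
      have "d i = 0" for i
      proof (cases "i \<in> ?I")
        case True
        then have "(\<lambda>j. if j = i then 1 else 0) \<in> words_on ?I" by (auto simp: words_on_def)
        from dual_codeD[OF dd this] True IF show ?thesis
          by (auto simp: if_distrib[of "(*) _"] cong: if_cong)
      qed (rule d0)
      then show "x = x'" by (simp add: d_def fun_eq_iff)
    next
      assume "x = x'"
      then show "d \<in> dual_code n (words_on ?I)" by (simp add: d_def dual_code_def Fn_def)
    qed
    finally show ?thesis .
  qed
  finally show "(\<Sum>y\<in>Fn n. cnj (encoder y x) * encoder y x') = (if x = x' then 1 else 0)" .
qed

text \<open>Of the sum over inputs only \<open>x0\<close> survives: \<open>fourier\<close> copies
  the coordinates outside the second block, and the input has zero ancillas inside it. The character
  is then one, and the normalisations of Fourier transform and ebits combine to the exponent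
  \<open>s + c\<close>.\<close>

lemma encoder_ea_input:
  "apply_sender n encoder (ea_input n k c \<phi>) y = (if y \<in> zsupp
     then \<phi> (restr k (coords y)) / complex_of_real (sqrt (real CARD('a)) ^ (s + c)) else 0)"
proof -
  let ?I = "{k..<k + s}"
  let ?t = "\<lambda>x. fourier (coords y) x * ea_input n k c \<phi> (glue n x y)"
  define x0 where "x0 i = (if i \<in> ?I then 0 else coords y i)" for i
  have x0F: "x0 \<in> Fn n" using coords_Fn[of y] by (auto simp: x0_def Fn_def)
  have "apply_sender n encoder (ea_input n k c \<phi>) y = (\<Sum>x\<in>Fn n. ?t x)"
    by (simp add: apply_sender_def encoder_def coords_def)
  also have "\<dots> = (\<Sum>x\<in>{x0}. ?t x)"
  proof (rule sum.mono_neutral_right)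
    show "\<forall>x\<in>Fn n - {x0}. ?t x = 0"
    proof
      fix x assume x: "x \<in> Fn n - {x0}"
      show "?t x = 0"
      proof (rule ccontr)
        assume "?t x \<noteq> 0"
        then have f: "fourier (coords y) x \<noteq> 0" and e: "ea_input n k c \<phi> (glue n x y) \<noteq> 0" by auto
        have 1: "\<forall>i<n. i \<notin> ?I \<longrightarrow> coords y i = x i"
          using f by (auto simp: fourier_def split: if_splits)
        have 2: "\<forall>i. k \<le> i \<and> i < n - c \<longrightarrow> glue n x y i = 0"
          using e unfolding ea_input_def by presburger
        have "x = x0"
        proof
          fix i
          consider "i \<in> ?I" | "i \<notin> ?I" "i < n" | "i \<ge> n" by fastforce
          then show "x i = x0 i"
          proof cases
            case 1
            then have "glue n x y i = x i" "k \<le> i \<and> i < n - c" using le_n by (auto simp: glue_def)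
            then show ?thesis using 2 1 by (simp add: x0_def)
          next
            case 2
            then have "x0 i = coords y i" by (simp only: x0_def if_False)
            then show ?thesis using 2 \<open>\<forall>i<n. _ i\<close> by simp
          next
            case 3
            then show ?thesis using x x0F by (auto simp: Fn_def)
          qed
        qed
        then show False using x by simp
      qed
    qed
  qed (use x0F in auto)
  also have "\<dots> = ?t x0" by simp
  also have "fourier (coords y) x0 = 1 / complex_of_real (sqrt (real CARD('a)) ^ s)"
    by (simp add: fourier_def x0_def)
  also have "ea_input n k c \<phi> (glue n x0 y) = (if y \<in> zsupp
      then \<phi> (restr k (coords y)) / complex_of_real (sqrt (real CARD('a)) ^ c) else 0)"
  proof -
    have "glue n x0 y \<in> Fn (n + c) \<longleftrightarrow> y \<in> Fn (n + c)"
      by (auto simp: glue_def Fn_def)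
    moreover have "(\<forall>i. k \<le> i \<and> i < n - c \<longrightarrow> glue n x0 y i = 0)
        \<longleftrightarrow> (\<forall>i. k + s \<le> i \<and> i < n - c \<longrightarrow> coords y i = 0)"
      using le_n by (auto simp: glue_def x0_def)
    moreover have "(\<forall>j<c. glue n x0 y (n - c + j) = glue n x0 y (n + j))
        \<longleftrightarrow> (\<forall>j<c. coords y (n - c + j) = y (n + j))"
      using le_n by (auto simp: glue_def x0_def)
    moreover have "restr k (glue n x0 y) = restr k (coords y)"
      using le_n by (auto simp: restr_def glue_def x0_def fun_eq_iff)
    ultimately show ?thesis
      unfolding ea_input_def zsupp_def by (simp only: mem_Collect_eq)
  qed
  finally show ?thesis by (simp add: power_add)
qed

text \<open>Encoded amplitudes on \<open>zsupp\<close> depend on the information coordinates only.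
  Conversely, labels in \<open>zsupp\<close> with equal information coordinates differ by an element
  of \<open>xgroup\<close>, so invariance lets \<open>\<phi>\<close> be read off from one
  representative each.\<close>

lemma codespace_encoder:
  "codespace = {apply_sender n encoder (ea_input n k c \<phi>) |\<phi>. \<phi> \<in> Hspace k}"
proof (intro equalityI subsetI)
  fix \<psi> assume "\<psi> \<in> codespace"
  then have out: "\<And>y. y \<notin> zsupp \<Longrightarrow> \<psi> y = 0" and inv: "\<And>y g. g \<in> xgroup \<Longrightarrow> \<psi> (y + g) = \<psi> y"
    by (auto simp: codespace_def)
  let ?K = "complex_of_real (sqrt (real CARD('a)) ^ (s + c))"
  have K: "?K \<noteq> 0" by (simp add: zero_less_card_finite)
  define L where "L = inv_into (Fn n) M"
  \<comment> \<open>\<open>L x\<close> is the representative with coordinates \<open>x\<close> and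
    zero at the receiver; \<open>?K\<close> cancels the normalisation of the encoder.\<close>
  define \<phi> where "\<phi> x = (if x \<in> Fn k then \<psi> (L x) * ?K else 0)" for x
  have "\<phi> \<in> Hspace k" by (simp add: Hspace_def \<phi>_def)
  moreover have "\<psi> = apply_sender n encoder (ea_input n k c \<phi>)"
  proof
    fix y
    show "\<psi> y = apply_sender n encoder (ea_input n k c \<phi>) y"
    proof (cases "y \<in> zsupp")
      case True
      define x where "x = restr k (coords y)"
      have xk: "x \<in> Fn k" by (simp add: x_def restr_Fn)
      then have xn: "x \<in> Fn n" using le_n by (auto simp: Fn_def)
      have LF: "L x \<in> Fn n"
        unfolding L_def using bij_betwE[OF bij_betw_inv_into[OF M_bij]] xn by blast
      have cL: "coords (L x) = x"
        using bij_betw_inv_into_right[OF M_bij xn] by (simp add: coords_def restr_id[OF LF] flip: L_def)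
      have "y - L x \<in> xgroup"
        unfolding xgroup_def zsupp_def mem_Collect_eq
      proof (intro conjI allI impI)
        show "y - L x \<in> Fn (n + c)"
          using True LF by (auto simp: zsupp_def Fn_def)
        show "coords (y - L x) i = 0" if "k + s \<le> i \<and> i < n - c" for i
          using True that xk by (auto simp: coords_diff cL zsupp_def Fn_def)
        show "coords (y - L x) (n - c + j) = (y - L x) (n + j)" if "j < c" for j
          using True that xk LF le_n by (auto simp: coords_diff cL zsupp_def Fn_def)
        show "coords (y - L x) i = 0" if "i < k" for i
          using that by (simp add: coords_diff cL) (simp add: x_def restr_def)
      qed
      then have "\<psi> (L x + (y - L x)) = \<psi> (L x)" by (rule inv)
      moreover have "L x + (y - L x) = y" by (simp add: fun_eq_iff)
      ultimately have "\<psi> y = \<psi> (L x)" by simp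
      then show ?thesis using True K xk by (simp add: encoder_ea_input \<phi>_def flip: x_def)
    next
      case False
      then show ?thesis by (simp add: encoder_ea_input out)
    qed
  qed
  ultimately show "\<psi> \<in> {apply_sender n encoder (ea_input n k c \<phi>) |\<phi>. \<phi> \<in> Hspace k}" by blast
next
  fix \<psi> assume "\<psi> \<in> {apply_sender n encoder (ea_input n k c \<phi>) |\<phi>. \<phi> \<in> Hspace k}"
  then obtain \<phi> where \<psi>: "\<psi> = apply_sender n encoder (ea_input n k c \<phi>)" by blast
  have "\<psi> y = 0" if "y \<notin> zsupp" for y using that by (simp add: \<psi> encoder_ea_input)
  moreover have "\<psi> \<in> Hspace (n + c)"
    using linear_codeD(1)[OF linear_zsupp] by (auto simp: Hspace_def \<psi> encoder_ea_input)
  moreover have "\<psi> (y + g) = \<psi> y" if g: "g \<in> xgroup" for y g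
  proof -
    have "restr k (coords (y + g)) = restr k (coords y)"
      using g by (auto simp: coords_add restr_def xgroup_def fun_eq_iff)
    then show ?thesis using zsupp_add_xgroup[OF g, of y] by (simp only: \<psi> encoder_ea_input)
  qed
  ultimately show "\<psi> \<in> codespace" by (simp add: codespace_def)
qed

text \<open>With nothing at the receiver, the ebit condition of \<open>zsupp\<close> makes the last
  \<open>c\<close> coordinates vanish too.\<close>

lemma zsupp_sender:
  assumes "a \<in> Fn n" "a \<in> zsupp"
  shows "\<forall>i\<ge>k + s. M a i = 0"
proof (intro allI impI)
  fix i assume i: "k + s \<le> i"
  have ca: "coords a = M a" by (simp add: coords_def restr_id assms)
  consider "i < n - c" | "n - c \<le> i" "i < n" | "n \<le> i" by linarith
  then show "M a i = 0"
  proof cases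
    case 1
    then show ?thesis using assms(2) i by (auto simp: zsupp_def ca)
  next
    case 2
    define j where "j = i - (n - c)"
    have "i = n - c + j" "j < c" using 2 le_n by (auto simp: j_def)
    then show ?thesis using assms by (auto simp: zsupp_def ca Fn_def)
  next
    case 3
    then show ?thesis using coords_Fn[of a] by (auto simp: ca Fn_def)
  qed
qed

text \<open>The receiver part is free to be chosen as a copy of the ebit coordinates.\<close>

lemma xgroup_lift:
  assumes v: "v \<in> Fn n" and zero: "\<forall>i. i < k \<or> k + s \<le> i \<and> i < n - c \<longrightarrow> M v i = 0"
  shows "\<exists>g\<in>xgroup. \<forall>i<n. g i = v i"
proof -
  \<comment> \<open>The shift by \<open>c\<close> takes receiver position \<open>n + j\<close> to
    its partner \<open>n - c + j\<close>.\<close>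
  define g where "g i = (if i < n then v i else if i < n + c then M v (i - c) else 0)" for i
  have "restr n g = v" using v by (auto simp: restr_def g_def Fn_def fun_eq_iff)
  then have cg: "coords g = M v" by (simp add: coords_def)
  have "g \<in> xgroup"
    unfolding xgroup_def zsupp_def mem_Collect_eq cg
  proof (intro conjI allI impI)
    show "g \<in> Fn (n + c)" by (simp add: g_def Fn_def)
    show "M v (n - c + j) = g (n + j)" if "j < c" for j
    proof -
      have "n + j - c = n - c + j" using le_n by simp
      then show ?thesis using that by (simp add: g_def)
    qed
  qed (use zero in auto)
  moreover have "\<forall>i<n. g i = v i" by (simp add: g_def)
  ultimately show ?thesis by blast
qed

text \<open>The hypothesis \<open>dist\<close> is the classical content. An error that escapes both
  detection lemmas has its X part on the first two blocks and its Z part orthogonal to all words on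
  the second and last block; below weight \<open>d\<close> only the identity may do so.\<close>

lemma quenta_codespace:
  assumes dist: "\<And>a b. a \<in> Fn n \<Longrightarrow> b \<in> Fn n \<Longrightarrow> sweight n a b < d \<Longrightarrow> \<forall>i\<ge>k + s. M a i = 0 \<Longrightarrow>
      (\<And>v. v \<in> Fn n \<Longrightarrow> \<forall>i. i < k \<or> k + s \<le> i \<and> i < n - c \<longrightarrow> M v i = 0 \<Longrightarrow> (\<Sum>i<n. b i * v i) = 0)
      \<Longrightarrow> a = 0 \<and> b = 0"
  shows "quenta_code n k d c codespace"
  unfolding quenta_code_def
proof (intro conjI ballI impI)
  show "k + c \<le> n" using le_n by simp
  show "\<exists>U. unitary_on n U \<and> codespace = {apply_sender n U (ea_input n k c \<phi>) |\<phi>. \<phi> \<in> Hspace k}"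
    using unitary_encoder codespace_encoder by blast
  let ?S = "(\<lambda>a. (1, a, 0)) ` xgroup \<union> (\<lambda>b. (1, 0, b)) ` dual_code (n + c) zsupp"
  have "\<forall>(ph, a, b)\<in>?S. a \<in> Fn (n + c) \<and> b \<in> Fn (n + c)"
    using linear_codeD(1)[OF linear_xgroup] by (auto simp: dual_code_def) (auto simp: Fn_def)
  then show "\<exists>S. (\<forall>(ph, a, b)\<in>S. a \<in> Fn (n + c) \<and> b \<in> Fn (n + c)) \<and>
      codespace = {\<psi> \<in> Hspace (n + c). \<forall>(ph, a, b)\<in>S. (\<lambda>y. ph * pauli (n + c) a b \<psi> y) = \<psi>}"
    using codespace_stabilizer by (intro exI[of _ ?S] conjI)
next
  fix a b :: "'a word" assume ab: "a \<in> Fn n" "b \<in> Fn n" "sweight n a b < d"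
  show "detectable (n + c) codespace (pauli (n + c) a b)"
  proof (cases "a \<in> zsupp \<and> (\<forall>g\<in>xgroup. (\<Sum>i<n + c. b i * g i) = 0)")
    case False
    then show ?thesis using detectable_X detectable_Z by blast
  next
    case True
    \<comment> \<open>Orthogonality to \<open>xgroup\<close> on all qudits reduces to the sender,
      since \<open>b\<close> vanishes at the receiver.\<close>
    have "(\<Sum>i<n. b i * v i) = 0"
      if v: "v \<in> Fn n" "\<forall>i. i < k \<or> k + s \<le> i \<and> i < n - c \<longrightarrow> M v i = 0" for v
    proof -
      obtain g where g: "g \<in> xgroup" "\<forall>i<n. g i = v i" using xgroup_lift[OF v] by blast
      have "(\<Sum>i<n. b i * v i) = (\<Sum>i<n. b i * g i)" using g(2) by simp
      also have "\<dots> = (\<Sum>i<n + c. b i * g i)"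
        by (rule sum.mono_neutral_left) (use ab(2) in \<open>auto simp: Fn_def\<close>)
      finally show ?thesis using True g(1) by simp
    qed
    then have "a = 0 \<and> b = 0" using dist[OF ab zsupp_sender] ab True by blast
    then show ?thesis using detectable_identity by simp
  qed
qed

end

section \<open>Parameters and distance for two cyclic codes\<close>

lemma min_weight:
  assumes "has_params n k d C" "a \<in> C" "a \<noteq> 0"
  shows "d \<le> card {i. i < n \<and> a i \<noteq> 0}"
proof -
  have "0 \<in> C" using assms(1) by (auto simp: has_params_def linear_code_def)
  then have "d \<le> hdist n a 0" using assms by (auto simp: has_params_def)
  then show ?thesis by (simp add: hdist_def)
qed

theorem mainTheorem1:
  fixes C1 C2 :: "('a::{finite,field}) word set"
    and emb :: "'a \<Rightarrow> 'b::field" and \<alpha> :: 'b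
    and n k1 k2 d1 d2 :: nat
  assumes "n \<ge> 1" and "coprime n CARD('a)"
    and "cyclic_code n C1" and "cyclic_code n C2"
    and "has_params n k1 d1 C1" and "has_params n k2 d2 C2"
    and "field_hom emb" and "primitive_root_of_unity n \<alpha>"
  shows "\<exists>Q :: 'a state set. quenta_code n
      (k1 - card (defining_set emb \<alpha> n (dual_code n C1) \<inter> defining_set emb \<alpha> n C2))
      (min d1 d2)
      (n - k2 - card (defining_set emb \<alpha> n (dual_code n C1) \<inter> defining_set emb \<alpha> n C2)) Q"
proof -
  let ?V = "dual_code n C1"
  let ?Z = "defining_set emb \<alpha> n ?V \<inter> defining_set emb \<alpha> n C2"
  let ?D = "{a + b |a b. a \<in> C2 \<and> b \<in> ?V}"
  have lin1: "linear_code n C1" and lin2: "linear_code n C2"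
    using assms(3,4) by (auto simp: cyclic_code_def)
  have cycV: "cyclic_code n ?V" by (rule cyclic_code_dual[OF assms(1,3)])
  \<comment> \<open>Here \<open>C2\<close> takes the role of \<open>A\<close> and the dual of
    \<open>C1\<close> that of \<open>B\<close>.\<close>
  obtain M k s c where M: "bij_betw M (Fn n) (Fn n)"
    "\<And>u v. u \<in> Fn n \<Longrightarrow> v \<in> Fn n \<Longrightarrow> M (u + v) = M u + M v"
    "\<And>t u. u \<in> Fn n \<Longrightarrow> M (cscale t u) = cscale t (M u)"
    "k + s + c \<le> n"
    and C2: "C2 = {y \<in> Fn n. \<forall>i\<ge>k + s. M y i = 0}"
    and V: "?V = {y \<in> Fn n. \<forall>i. i < k \<or> k + s \<le> i \<and> i < n - c \<longrightarrow> M y i = 0}"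
    and cards: "card C2 = CARD('a) ^ (k + s)" "card ?V = CARD('a) ^ (s + c)"
    "card ?D = CARD('a) ^ (k + s + c)"
    using adapted_coordinates[OF lin2 linear_code_dual[of n C1]] by blast
  interpret ea_coordinates M n k s c using M by unfold_locales
  have inj: "CARD('a) ^ i = CARD('a) ^ j \<Longrightarrow> i = j" for i j
    using CARD_gt_1[where 'a='a] by simp
  have "k1 = code_dim C1" "k2 = code_dim C2" using assms(5,6) by (auto simp: has_params_def)
  then have "card C1 = CARD('a) ^ k1" "card C2 = CARD('a) ^ k2"
    using card_code[OF lin1] card_code[OF lin2] by auto
  then have "CARD('a) ^ (k1 + (s + c)) = CARD('a) ^ n" "CARD('a) ^ k2 = CARD('a) ^ (k + s)"
    using card_dual_code[OF lin1] cards by (auto simp: power_add)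
  then have k12: "k1 + (s + c) = n" "k2 = k + s" by (auto dest: inj)
  have "card ?D * CARD('a) ^ card (defining_set emb \<alpha> n ?D) = CARD('a) ^ n"
    by (rule card_cyclic_code_defining_set[OF assms(1) cyclic_code_sum[OF assms(4) cycV] assms(7,8)])
  moreover have "defining_set emb \<alpha> n ?D = ?Z"
    using defining_set_sum[OF assms(7) lin2 linear_code_dual[of n C1]] by (simp only: Int_commute)
  ultimately have "CARD('a) ^ (k + s + c + card ?Z) = CARD('a) ^ n"
    using cards(3) by (metis power_add)
  then have "k + s + c + card ?Z = n" by (rule inj)
  \<comment> \<open>With \<open>card ?Z = n - (k + s + c)\<close>, \<open>k1 = n - s - c\<close> and
    \<open>k2 = k + s\<close>, no natural subtraction is truncated.\<close>
  then have "k1 - card ?Z = k" "n - k2 - card ?Z = c" using k12 by auto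
  moreover have "quenta_code n k (min d1 d2) c codespace"
  proof (rule quenta_codespace)
    fix a b :: "'a word"
    assume ab: "a \<in> Fn n" "b \<in> Fn n" "sweight n a b < min d1 d2" "\<forall>i\<ge>k + s. M a i = 0"
      and perp: "\<And>v. v \<in> Fn n \<Longrightarrow> \<forall>i. i < k \<or> k + s \<le> i \<and> i < n - c \<longrightarrow> M v i = 0 \<Longrightarrow>
        (\<Sum>i<n. b i * v i) = 0"
    have "a \<in> C2" unfolding C2 using ab by simp
    have "\<forall>v\<in>?V. (\<Sum>i<n. b i * v i) = 0" unfolding V using perp by simp
    then have "b \<in> dual_code n ?V" using ab(2) by (simp add: dual_code_def[of _ ?V])
    then have "b \<in> C1" by (simp only: dual_dual_code[OF lin1])
    \<comment> \<open>The weight of the error bounds those of \<open>a\<close> and \<open>b\<close>,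
      so a nonzero one among them would violate the minimum distance of its code.\<close>
    have "card {i. i < n \<and> a i \<noteq> 0} \<le> sweight n a b" "card {i. i < n \<and> b i \<noteq> 0} \<le> sweight n a b"
      unfolding sweight_def by (rule card_mono; auto)+
    then show "a = 0 \<and> b = 0"
      using min_weight[OF assms(6) \<open>a \<in> C2\<close>] min_weight[OF assms(5) \<open>b \<in> C1\<close>] ab(3) by fastforce
  qed
  ultimately show ?thesis by auto
qed

end
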